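(* Let $k_0$ be a perfect field of characteristic $p>0$, $X,Z_1,Z_2$ algebraically independent over $k_0$, and $k=k_0(X,Z_1,Z_2)$. Put $\theta_1=Z_1^{p^{-1}}X^{p^{-2}}+Z_2^{p^{-1}}$ and for $n\ge2$, $\theta_n=Z_1^{p^{-1}}X^{p^{-2n}}+\theta_{n-1}^{p^{-1}}=Z_1^{p^{-1}}X^{p^{-2n}}+Z_1^{p^{-2}}X^{p^{-2n+1}}+\cdots+Z_1^{p^{-n}}X^{p^{-n-1}}+Z_2^{p^{-n}}$. Let $K_n=k(X^{p^{-2n}},\theta_n)$ (so $K_n\subseteq K_{n+1}$) and $K=\bigcup_n K_n$. Then $lm(K/k)=k(X^{p^{-\infty}})$; in particular $K/k$ is not lq-modular.
   Context: Fields lie in an algebraic closure of $k$. $k(X^{p^{-\infty}})=\bigcup_n k(X^{p^{-n}})$. $K/k$ is modular if for every $n$, $K^{p^n}$ and $k$ are $(k\cap K^{p^n})$-linearly disjoint; $lm(K/k)$ denotes the smallest intermediate field $m$ of $K/k$ with $K/m$ modular. A q-finite purely inseparable $K/k$ (i.e. with $\sup_n$ of the minimal number of generators of $(k^{p^{-n}}\cap K)/k$ finite) is lq-modular if $K$ is modular over a finite subextension of $K/k$. *)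

theory Defs
  imports Main "HOL-Computational_Algebra.Primes"
begin

text \<open>All fields are subfields of an ambient field of type 'a (a type-class field).\<close>

definition is_subfield :: "'a::field set \<Rightarrow> bool" where
  "is_subfield S \<longleftrightarrow> 0 \<in> S \<and> 1 \<in> S \<and>
     (\<forall>x\<in>S. \<forall>y\<in>S. x + y \<in> S \<and> x * y \<in> S) \<and>
     (\<forall>x\<in>S. - x \<in> S \<and> inverse x \<in> S)"

definition gen_field :: "'a::field set \<Rightarrow> 'a set \<Rightarrow> 'a set" where
  "gen_field F A = \<Inter> {S. is_subfield S \<and> F \<union> A \<subseteq> S}"

text \<open>The unique p^n-th root x^(p^-n) (in a perfect ambient field of characteristic p).\<close>
definition proot :: "nat \<Rightarrow> nat \<Rightarrow> 'a::field \<Rightarrow> 'a" where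
  "proot p n x = (THE y. y ^ (p ^ n) = x)"

definition lin_indep :: "'a::field set \<Rightarrow> 'a set \<Rightarrow> bool" where
  "lin_indep F S \<longleftrightarrow> (\<forall>c. (\<forall>s\<in>S. c s \<in> F) \<and> (\<Sum>s\<in>S. c s * s) = 0 \<longrightarrow> (\<forall>s\<in>S. c s = 0))"

definition lin_disjoint :: "'a::field set \<Rightarrow> 'a set \<Rightarrow> 'a set \<Rightarrow> bool" where
  "lin_disjoint C A B \<longleftrightarrow>
     (\<forall>S. finite S \<and> S \<subseteq> A \<and> lin_indep C S \<longrightarrow> lin_indep B S)"

definition ppow_set :: "nat \<Rightarrow> nat \<Rightarrow> 'a::field set \<Rightarrow> 'a set" where
  "ppow_set p n K = (\<lambda>x. x ^ (p ^ n)) ` K"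

definition modular :: "nat \<Rightarrow> 'a::field set \<Rightarrow> 'a set \<Rightarrow> bool" where
  "modular p k K \<longleftrightarrow> k \<subseteq> K \<and>
     (\<forall>n. lin_disjoint (k \<inter> ppow_set p n K) (ppow_set p n K) k)"

definition is_lm :: "nat \<Rightarrow> 'a::field set \<Rightarrow> 'a set \<Rightarrow> 'a set \<Rightarrow> bool" where
  "is_lm p k K m \<longleftrightarrow>
     (is_subfield m \<and> k \<subseteq> m \<and> m \<subseteq> K \<and> modular p m K) \<and>
     (\<forall>m'. is_subfield m' \<and> k \<subseteq> m' \<and> m' \<subseteq> K \<and> modular p m' K \<longrightarrow> m \<subseteq> m')"

definition purely_insep :: "nat \<Rightarrow> 'a::field set \<Rightarrow> 'a set \<Rightarrow> bool" where
  "purely_insep p k K \<longleftrightarrow> k \<subseteq> K \<and> (\<forall>x\<in>K. \<exists>n. x ^ (p ^ n) \<in> k)"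

definition q_finite :: "nat \<Rightarrow> 'a::field set \<Rightarrow> 'a set \<Rightarrow> bool" where
  "q_finite p k K \<longleftrightarrow> (\<exists>B::nat. \<forall>n. \<exists>S. finite S \<and> card S \<le> B \<and>
      gen_field k S = {x \<in> K. x ^ (p ^ n) \<in> k})"

definition fin_dim :: "'a::field set \<Rightarrow> 'a set \<Rightarrow> bool" where
  "fin_dim k L \<longleftrightarrow> (\<exists>S. finite S \<and> S \<subseteq> L \<and>
      L = {y. \<exists>c. (\<forall>s\<in>S. c s \<in> k) \<and> y = (\<Sum>s\<in>S. c s * s)})"

definition lq_modular :: "nat \<Rightarrow> 'a::field set \<Rightarrow> 'a set \<Rightarrow> bool" where
  "lq_modular p k K \<longleftrightarrow> q_finite p k K \<and> purely_insep p k K \<and>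
     (\<exists>L. is_subfield L \<and> k \<subseteq> L \<and> L \<subseteq> K \<and> fin_dim k L \<and> modular p L K)"

definition alg_indep3 :: "'a::field set \<Rightarrow> 'a \<Rightarrow> 'a \<Rightarrow> 'a \<Rightarrow> bool" where
  "alg_indep3 k0 X Y Z \<longleftrightarrow> (\<forall>(c::nat \<Rightarrow> nat \<Rightarrow> nat \<Rightarrow> 'a) N.
     (\<forall>i j l. c i j l \<in> k0) \<and>
     (\<Sum>i\<le>N. \<Sum>j\<le>N. \<Sum>l\<le>N. c i j l * X ^ i * Y ^ j * Z ^ l) = 0 \<longrightarrow>
     (\<forall>i\<le>N. \<forall>j\<le>N. \<forall>l\<le>N. c i j l = 0))"

text \<open>theta 0 = Z2, theta n = Z1^(p^-1) X^(p^-2n) + (theta (n-1))^(p^-1); theta n for n \<ge> 1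
  is the paper's \<theta>_n.\<close>
primrec theta :: "nat \<Rightarrow> 'a::field \<Rightarrow> 'a \<Rightarrow> 'a \<Rightarrow> nat \<Rightarrow> 'a" where
  "theta p X Z1 Z2 0 = Z2"
| "theta p X Z1 Z2 (Suc n) =
     proot p 1 Z1 * proot p (2 * Suc n) X + proot p 1 (theta p X Z1 Z2 n)"

end

(* Write x_n = X^(p^-n), E = k0(x_0, x_1, ...), N = E(Z1) and M = N(Z2). Since theta_n^(p^n) lies
   in Z2 + N, each theta_n is transcendental over N, M = N(theta_n^(p^n)), and K is the increasing
   union of the fields N(theta_n).

   K/M is modular: for s <= n, K^(p^s) is exhausted by the fields generated over a subfield of
   C = M \<inter> K^(p^s) by t = theta_n^(p^s). Such a field lies in C[t], which is spanned over C by
   1, t, ..., t^(d-1) with d = p^(n-s), and these powers are linearly independent over M = N(t^d).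

   M is contained in every m with K/m modular: otherwise let n = s+1 be least with x_n not in m.
   Then c = theta_n^(p^n) is mu + Z1^(p^s) x_n with mu in m, while linear disjointness gives a
   relation of the same shape with coefficients in m \<inter> K^(p^n). As x_n is not in m, the
   coefficients agree, so Z1^(p^s) is in K^(p^n) and Z1^(1/p) is in K. But a p-th root of an element
   of N that lies in the purely transcendental N(theta_n) lies in N = E(Z1), and the degree in Z1
   rules out Z1^(1/p) there.

   A finite L/k inside K has L^(p^e) inside k for some e. If K/L were modular, then x_(e+1) would be
   in L, and x_1 = x_(e+1)^(p^e) would be in k, which the same two arguments exclude. *)

theory Submission
  imports Defs "HOL-Computational_Algebra.Polynomial"
begin

subsection \<open>Subfields, fractions and transcendental elements\<close>

lemma is_subfieldD:
  assumes "is_subfield F"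
  shows "0 \<in> F" "1 \<in> F"
    and "\<And>x y. x \<in> F \<Longrightarrow> y \<in> F \<Longrightarrow> x + y \<in> F"
    and "\<And>x y. x \<in> F \<Longrightarrow> y \<in> F \<Longrightarrow> x * y \<in> F"
    and "\<And>x. x \<in> F \<Longrightarrow> - x \<in> F"
    and "\<And>x. x \<in> F \<Longrightarrow> inverse x \<in> F"
    and "\<And>x y. x \<in> F \<Longrightarrow> y \<in> F \<Longrightarrow> x - y \<in> F"
    and "\<And>x y. x \<in> F \<Longrightarrow> y \<in> F \<Longrightarrow> x / y \<in> F"
proof -
  show f: "0 \<in> F" "1 \<in> F" "\<And>x y. x \<in> F \<Longrightarrow> y \<in> F \<Longrightarrow> x + y \<in> F"
    "\<And>x y. x \<in> F \<Longrightarrow> y \<in> F \<Longrightarrow> x * y \<in> F" "\<And>x. x \<in> F \<Longrightarrow> - x \<in> F"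
    "\<And>x. x \<in> F \<Longrightarrow> inverse x \<in> F"
    using assms by (auto simp: is_subfield_def)
  show "x - y \<in> F" if "x \<in> F" "y \<in> F" for x y
    using f(3)[OF that(1) f(5)[OF that(2)]] by simp
  show "x / y \<in> F" if "x \<in> F" "y \<in> F" for x y
    using f(4)[OF that(1) f(6)[OF that(2)]] by (simp add: divide_inverse)
qed

definition is_subring :: "'a::field set \<Rightarrow> bool" where
  "is_subring R \<longleftrightarrow> 0 \<in> R \<and> 1 \<in> R \<and>
     (\<forall>x\<in>R. \<forall>y\<in>R. x + y \<in> R \<and> x * y \<in> R) \<and> (\<forall>x\<in>R. - x \<in> R)"

lemma is_subringD:
  assumes "is_subring R"
  shows "0 \<in> R" "1 \<in> R"
    and "\<And>x y. x \<in> R \<Longrightarrow> y \<in> R \<Longrightarrow> x + y \<in> R"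
    and "\<And>x y. x \<in> R \<Longrightarrow> y \<in> R \<Longrightarrow> x * y \<in> R"
    and "\<And>x. x \<in> R \<Longrightarrow> - x \<in> R"
  using assms by (auto simp: is_subring_def)

lemma is_subring_if_is_subfield: "is_subfield F \<Longrightarrow> is_subring F"
  by (auto simp: is_subring_def is_subfield_def)

lemma is_subring_sum:
  assumes "is_subring R" "\<And>i. i \<in> I \<Longrightarrow> f i \<in> R"
  shows "sum f I \<in> R"
  using assms(2)
  by (induction I rule: infinite_finite_induct) (auto intro: is_subringD[OF assms(1)])

lemma is_subring_power:
  assumes "is_subring R" "x \<in> R"
  shows "x ^ n \<in> R"
  using assms(2) by (induction n) (auto intro: is_subringD[OF assms(1)])

lemma is_subfield_Inter:
  assumes "\<And>S. S \<in> \<S> \<Longrightarrow> is_subfield S"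
  shows "is_subfield (\<Inter>\<S>)"
  using assms unfolding is_subfield_def by blast

lemma is_subfield_gen_field: "is_subfield (gen_field F A)"
  unfolding gen_field_def by (rule is_subfield_Inter) auto

lemma gen_field_superset: "F \<subseteq> gen_field F A" "A \<subseteq> gen_field F A"
  unfolding gen_field_def by auto

lemma gen_field_least:
  assumes "is_subfield S" "F \<subseteq> S" "A \<subseteq> S"
  shows "gen_field F A \<subseteq> S"
  unfolding gen_field_def using assms by auto

section \<open>Quotient fields and the rings R[t]\<close>

definition fracs :: "'a::field set \<Rightarrow> 'a set" where
  "fracs R = {a / b | a b. a \<in> R \<and> b \<in> R \<and> b \<noteq> 0}"

definition polys :: "'a::field set \<Rightarrow> 'a poly set" where
  "polys R = {q. \<forall>i. coeff q i \<in> R}"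

text \<open>This is only the ring R[t]; the field generated by R and t is
  \<open>gen_field R {t}\<close>.\<close>

definition adjoin :: "'a::field set \<Rightarrow> 'a \<Rightarrow> 'a set" where
  "adjoin R t = (\<lambda>q. poly q t) ` polys R"

text \<open>R may be just a ring, so that independence in three variables can be read off over k0,
  k0[X] and k0[X][Y] before passing to quotients.\<close>

definition transc :: "'a::field set \<Rightarrow> 'a \<Rightarrow> bool" where
  "transc R t \<longleftrightarrow> (\<forall>q\<in>polys R. poly q t = 0 \<longrightarrow> q = 0)"

lemma fracsE:
  assumes "x \<in> fracs R"
  obtains a b where "x = a / b" "a \<in> R" "b \<in> R" "b \<noteq> 0"
  using assms unfolding fracs_def by blast

lemma fracsI: "a \<in> R \<Longrightarrow> b \<in> R \<Longrightarrow> b \<noteq> 0 \<Longrightarrow> a / b \<in> fracs R"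
  unfolding fracs_def by blast

lemma fracs_superset:
  assumes "is_subring R"
  shows "R \<subseteq> fracs R"
proof
  fix x assume "x \<in> R"
  then show "x \<in> fracs R" using fracsI[of x R 1] is_subringD[OF assms] by simp
qed

lemma is_subfield_fracs:
  assumes R: "is_subring R"
  shows "is_subfield (fracs R)"
proof -
  note r = is_subringD[OF R]
  have "x + y \<in> fracs R \<and> x * y \<in> fracs R" if "x \<in> fracs R" "y \<in> fracs R" for x y
  proof -
    from that(1) obtain a b where x: "x = a / b" "a \<in> R" "b \<in> R" "b \<noteq> 0" by (rule fracsE)
    from that(2) obtain c d where y: "y = c / d" "c \<in> R" "d \<in> R" "d \<noteq> 0" by (rule fracsE)
    have "x + y = (a * d + c * b) / (b * d)" "x * y = (a * c) / (b * d)"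
      using x y by (auto simp: field_simps)
    then show ?thesis
      using x y by (auto intro!: fracsI r)
  qed
  moreover have "- x \<in> fracs R \<and> inverse x \<in> fracs R" if "x \<in> fracs R" for x
  proof -
    from that obtain a b where x: "x = a / b" "a \<in> R" "b \<in> R" "b \<noteq> 0" by (rule fracsE)
    have "- x = (- a) / b" using x by simp
    then have "- x \<in> fracs R" using x by (metis fracsI r(5))
    moreover have "inverse x \<in> fracs R"
    proof (cases "a = 0")
      case True
      then show ?thesis using x r(1) fracs_superset[OF R] by auto
    next
      case False
      then show ?thesis using x by (auto intro: fracsI)
    qed
    ultimately show ?thesis by simp
  qed
  ultimately show ?thesis
    using r(1,2) fracs_superset[OF R] unfolding is_subfield_def by (simp add: subset_iff)
qed

lemma fracs_least:
  assumes "is_subfield S" "R \<subseteq> S"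
  shows "fracs R \<subseteq> S"
  using assms(2) is_subfieldD(8)[OF assms(1)] by (auto simp: fracs_def)

lemma fracs_subfield: "is_subfield F \<Longrightarrow> fracs F = F"
  by (metis equalityI fracs_least fracs_superset is_subring_if_is_subfield order_refl)

text \<open>The product of all denominators serves. The index set lets this clear denominators both
  in a polynomial and in a linear relation.\<close>

lemma common_denominator:
  assumes R: "is_subring R" and "finite I" "\<And>i. i \<in> I \<Longrightarrow> c i \<in> fracs R"
  obtains b where "b \<in> R" "b \<noteq> 0" "\<And>i. i \<in> I \<Longrightarrow> b * c i \<in> R"
proof -
  note r = is_subringD[OF R]
  have "\<exists>b\<in>R. b \<noteq> 0 \<and> (\<forall>i\<in>I. b * c i \<in> R)"
    using assms(2,3)
  proof (induction I rule: finite_induct)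
    case empty
    then show ?case using r(2) by (intro bexI[of _ 1]) auto
  next
    case (insert j I)
    then obtain b where b: "b \<in> R" "b \<noteq> 0" "\<And>i. i \<in> I \<Longrightarrow> b * c i \<in> R" by auto
    from insert.prems[of j] obtain u v where uv: "c j = u / v" "u \<in> R" "v \<in> R" "v \<noteq> 0"
      by (auto elim: fracsE)
    have "b * v * c i \<in> R" if "i \<in> insert j I" for i
    proof (cases "i = j")
      case True
      then have "b * v * c i = b * u" using uv by simp
      then show ?thesis using r(4)[OF b(1) uv(2)] by metis
    next
      case False
      then have "b * v * c i = v * (b * c i)" by simp
      moreover have "v * (b * c i) \<in> R" using r(4)[OF uv(3) b(3)] that False by auto
      ultimately show ?thesis by metis
    qed
    then show ?case using b uv r(4) by (intro bexI[of _ "b * v"]) auto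
  qed
  then show ?thesis using that by blast
qed

lemma polys_coeff: "q \<in> polys R \<Longrightarrow> coeff q i \<in> R"
  by (simp add: polys_def)

lemma polys_pCons:
  assumes "is_subring R"
  shows "pCons a q \<in> polys R \<longleftrightarrow> a \<in> R \<and> q \<in> polys R"
proof
  assume *: "pCons a q \<in> polys R"
  show "a \<in> R \<and> q \<in> polys R"
    using polys_coeff[OF *, of 0] polys_coeff[OF *, of "Suc _"] by (auto simp: polys_def)
next
  assume "a \<in> R \<and> q \<in> polys R"
  then show "pCons a q \<in> polys R" by (auto simp: polys_def coeff_pCons split: nat.splits)
qed

lemma polys_closed:
  assumes R: "is_subring R"
  shows "0 \<in> polys R" "1 \<in> polys R"
    and "\<And>q r. q \<in> polys R \<Longrightarrow> r \<in> polys R \<Longrightarrow> q + r \<in> polys R"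
    and "\<And>q r. q \<in> polys R \<Longrightarrow> r \<in> polys R \<Longrightarrow> q * r \<in> polys R"
    and "\<And>q. q \<in> polys R \<Longrightarrow> - q \<in> polys R"
    and "\<And>c q. c \<in> R \<Longrightarrow> q \<in> polys R \<Longrightarrow> smult c q \<in> polys R"
    and "\<And>c n. c \<in> R \<Longrightarrow> monom c n \<in> polys R"
    and "\<And>q n. q \<in> polys R \<Longrightarrow> q ^ n \<in> polys R"
    and "\<And>q r. q \<in> polys R \<Longrightarrow> r \<in> polys R \<Longrightarrow> q - r \<in> polys R"
proof -
  note r = is_subringD[OF R]
  show one: "1 \<in> polys R" using r by (auto simp: polys_def coeff_1)
  show mult: "q * s \<in> polys R" if "q \<in> polys R" "s \<in> polys R" for q s
    using that r(4) by (auto simp: polys_def coeff_mult intro!: is_subring_sum[OF R])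
  show "q - s \<in> polys R" if "q \<in> polys R" "s \<in> polys R" for q s
    using that r(3)[OF _ r(5)] by (auto simp: polys_def)
  show "q ^ n \<in> polys R" if "q \<in> polys R" for q n
    by (induction n) (auto intro: one mult that)
qed (use is_subringD[OF R] in \<open>auto simp: polys_def coeff_monom\<close>)

lemma polys_sum:
  assumes R: "is_subring R" and "\<And>i. i \<in> I \<Longrightarrow> f i \<in> polys R"
  shows "sum f I \<in> polys R"
  using assms(2)
  by (induction I rule: infinite_finite_induct) (auto intro: polys_closed[OF R])

lemma adjoinI: "q \<in> polys R \<Longrightarrow> poly q t \<in> adjoin R t"
  by (simp add: adjoin_def)

lemma is_subring_adjoin:
  assumes R: "is_subring R"
  shows "is_subring (adjoin R t)"
  unfolding is_subring_def
proof (intro conjI ballI)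
  note p = polys_closed[OF R]
  show "0 \<in> adjoin R t" "1 \<in> adjoin R t"
    using adjoinI[OF p(1), of t] adjoinI[OF p(2), of t] by simp_all
  fix x assume "x \<in> adjoin R t"
  then obtain q where q: "q \<in> polys R" "x = poly q t" by (auto simp: adjoin_def)
  show "- x \<in> adjoin R t" using adjoinI[OF p(5)[OF q(1)], of t] q by simp
  fix y assume "y \<in> adjoin R t"
  then obtain s where s: "s \<in> polys R" "y = poly s t" by (auto simp: adjoin_def)
  show "x + y \<in> adjoin R t" "x * y \<in> adjoin R t"
    using adjoinI[OF p(3)[OF q(1) s(1)], of t] adjoinI[OF p(4)[OF q(1) s(1)], of t] q s
    by simp_all
qed

lemma adjoin_superset:
  assumes R: "is_subring R"
  shows "R \<subseteq> adjoin R t" "t \<in> adjoin R t"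
proof -
  note p = polys_pCons[OF R] and r = is_subringD[OF R]
  show "R \<subseteq> adjoin R t"
  proof
    fix c assume "c \<in> R"
    then show "c \<in> adjoin R t"
      using adjoinI[of "[:c:]" R t] p polys_closed(1)[OF R] by auto
  qed
  show "t \<in> adjoin R t"
    using adjoinI[of "[:0,1:]" R t] p polys_closed(1)[OF R] r by auto
qed

lemma adjoin_least:
  assumes "is_subring S" "R \<subseteq> S" "t \<in> S"
  shows "adjoin R t \<subseteq> S"
proof
  fix x assume "x \<in> adjoin R t"
  then obtain q where q: "q \<in> polys R" "x = poly q t" by (auto simp: adjoin_def)
  show "x \<in> S"
    unfolding q(2) poly_altdef using q(1) assms
    by (auto intro!: is_subring_sum is_subringD(4) is_subring_power simp: polys_def)
qed

text \<open>Both sides are the smallest subfield containing R and t. As R need only be a ring,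
  k0(X)(Y) becomes the quotient field of k0[X][Y].\<close>

lemma gen_field_fracs:
  assumes R: "is_subring R"
  shows "gen_field (fracs R) {t} = fracs (adjoin R t)"
proof
  note a = is_subring_adjoin[OF R, of t] adjoin_superset[OF R, of t]
  show "gen_field (fracs R) {t} \<subseteq> fracs (adjoin R t)"
    using a fracs_superset[OF a(1)]
    by (intro gen_field_least is_subfield_fracs fracs_least) auto
  have "R \<subseteq> gen_field (fracs R) {t}"
    using fracs_superset[OF R] gen_field_superset(1) by blast
  then show "fracs (adjoin R t) \<subseteq> gen_field (fracs R) {t}"
    using gen_field_superset(2)[of "{t}"]
    by (intro fracs_least is_subfield_gen_field adjoin_least is_subring_if_is_subfield) auto
qed

lemma gen_field_singleton:
  assumes "is_subfield F"
  shows "gen_field F {t} = fracs (adjoin F t)"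
  using gen_field_fracs[OF is_subring_if_is_subfield[OF assms]] fracs_subfield[OF assms] by simp

section \<open>Transcendental elements\<close>

lemma transcD: "transc R t \<Longrightarrow> q \<in> polys R \<Longrightarrow> poly q t = 0 \<Longrightarrow> q = 0"
  by (simp add: transc_def)

text \<open>A common denominator of the coefficients turns a polynomial over the quotients into one
  over R with the same root.\<close>

lemma transc_fracs:
  assumes R: "is_subring R" and t: "transc R t"
  shows "transc (fracs R) t"
  unfolding transc_def
proof (intro ballI impI)
  fix q assume q: "q \<in> polys (fracs R)" "poly q t = 0"
  obtain b where b: "b \<in> R" "b \<noteq> 0" "\<And>i. i \<in> {..degree q} \<Longrightarrow> b * coeff q i \<in> R"
    using common_denominator[OF R, of "{..degree q}" "coeff q"] q(1) by (auto simp: polys_def)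
  have "b * coeff q i \<in> R" for i
    using b(3)[of i] is_subringD(1)[OF R] by (cases "i \<le> degree q") (auto simp: coeff_eq_0)
  then have "smult b q \<in> polys R" by (auto simp: polys_def)
  moreover have "poly (smult b q) t = 0" using q by simp
  ultimately have "smult b q = 0" by (rule transcD[OF t])
  then show "q = 0" using b by simp
qed

lemma poly_eq_sum_le:
  fixes q :: "'a::field poly"
  assumes "degree q \<le> N"
  shows "poly q x = (\<Sum>i\<le>N. coeff q i * x ^ i)"
  unfolding poly_altdef using assms by (intro sum.mono_neutral_left) (auto simp: coeff_eq_0)

text \<open>After clearing denominators each coefficient is a polynomial in \<open>t ^ d\<close>, so
  the j-th summand only involves exponents of t congruent to j modulo d. Different summands
  therefore cannot cancel.\<close>

lemma transc_lin_indep_powers: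
  assumes F: "is_subfield F" and t: "transc F t" and "0 < d"
    and c: "\<And>j. j < d \<Longrightarrow> c j \<in> gen_field F {t ^ d}" and s: "(\<Sum>j<d. c j * t ^ j) = 0"
    and j: "j < d"
  shows "c j = 0"
proof -
  note Fr = is_subring_if_is_subfield[OF F]
  obtain b where b: "b \<in> adjoin F (t ^ d)" "b \<noteq> 0"
    "\<And>i. i \<in> {..<d} \<Longrightarrow> b * c i \<in> adjoin F (t ^ d)"
    using common_denominator[OF is_subring_adjoin[OF Fr], of "{..<d}" c "t ^ d"] c
    unfolding gen_field_singleton[OF F] by auto
  have "\<forall>i. \<exists>q. i < d \<longrightarrow> q \<in> polys F \<and> b * c i = poly q (t ^ d)"
    using b(3) by (auto simp: adjoin_def)
  then obtain q where q: "\<And>i. i < d \<Longrightarrow> q i \<in> polys F \<and> b * c i = poly (q i) (t ^ d)"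
    by metis
  let ?D = "\<Sum>i<d. degree (q i)"
  \<comment> \<open>The cleared relation as one polynomial over F: \<open>k * d + i\<close> is the
    exponent of \<open>(t ^ d) ^ k * t ^ i\<close>.\<close>
  let ?P = "\<Sum>i<d. \<Sum>k\<le>?D. monom (coeff (q i) k) (k * d + i)"
  have D: "degree (q i) \<le> ?D" if "i < d" for i
    using that by (intro member_le_sum) auto
  have "?P \<in> polys F"
    using q by (intro polys_sum[OF Fr] polys_closed(7)[OF Fr]) (auto simp: polys_def)
  moreover have "poly ?P t = b * (\<Sum>j<d. c j * t ^ j)"
  proof -
    have "poly ?P t = (\<Sum>i<d. (\<Sum>k\<le>?D. coeff (q i) k * (t ^ d) ^ k) * t ^ i)"
      by (simp add: poly_sum poly_monom power_add power_mult sum_distrib_right mult.assoc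
          mult.commute[of _ d])
    also have "\<dots> = (\<Sum>i<d. poly (q i) (t ^ d) * t ^ i)"
      using poly_eq_sum_le[OF D, of _ "t ^ d"] by (intro sum.cong) auto
    also have "\<dots> = (\<Sum>i<d. b * (c i * t ^ i))"
      using q by (intro sum.cong refl) (auto simp flip: mult.assoc)
    finally show ?thesis by (simp add: sum_distrib_left)
  qed
  ultimately have P0: "?P = 0" using s by (intro transcD[OF t]) auto
  have "coeff (q j) n = 0" for n
  proof (cases "n \<le> ?D")
    case True
    \<comment> \<open>The residue modulo d recovers i, and then k, so the coefficient of
      \<open>?P\<close> at \<open>n * d + j\<close> is just \<open>coeff (q j) n\<close>.\<close>
    have eq: "k * d + i = n * d + j \<longleftrightarrow> i = j \<and> k = n" if "i < d" for i k
    proof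
      assume *: "k * d + i = n * d + j"
      have "i = j" using arg_cong[OF *, of "\<lambda>x. x mod d"] that j by simp
      then show "i = j \<and> k = n" using * \<open>0 < d\<close> by simp
    qed simp
    have "coeff ?P (n * d + j) = (\<Sum>i<d. \<Sum>k\<le>?D. if i = j \<and> k = n then coeff (q j) n else 0)"
      unfolding coeff_sum coeff_monom using eq by (intro sum.cong) auto
    also have "\<dots> = (\<Sum>i<d. if i = j then coeff (q j) n else 0)"
      using True by (intro sum.cong refl) (simp add: sum.delta)
    also have "\<dots> = coeff (q j) n" using j by simp
    finally show ?thesis using P0 by simp
  next
    case False
    then show ?thesis using D[OF j] by (intro coeff_eq_0) linarith
  qed
  then have "q j = 0" by (simp add: poly_eq_iff)
  then show ?thesis using q[OF j] b(2) by simp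
qed

text \<open>Horner's scheme: multiplication by t shifts the coordinates, and the overflow
  \<open>t ^ d\<close>, an element of C, is absorbed into the constant one.\<close>

lemma adjoin_eq_span:
  assumes C: "is_subfield C" and t: "t ^ d \<in> C" and d: "0 < d"
    and x: "x \<in> adjoin C t"
  shows "\<exists>f. (\<forall>j<d. f j \<in> C) \<and> x = (\<Sum>j<d. f j * t ^ j)"
proof -
  note cr = is_subring_if_is_subfield[OF C]
  from x obtain q where "q \<in> polys C" "x = poly q t" by (auto simp: adjoin_def)
  then show ?thesis
  proof (induction q arbitrary: x)
    case 0
    then show ?case using is_subfieldD(1)[OF C] by (intro exI[of _ "\<lambda>_. 0"]) simp
  next
    case (pCons a q)
    then obtain f where f: "\<forall>j<d. f j \<in> C" "poly q t = (\<Sum>j<d. f j * t ^ j)" and a: "a \<in> C"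
      using polys_pCons[OF cr] by blast
    obtain d' where d': "d = Suc d'" using d by (cases d) auto
    let ?g = "\<lambda>j. case j of 0 \<Rightarrow> a + f d' * t ^ d | Suc i \<Rightarrow> f i"
    have "x = a + t * ((\<Sum>j<d'. f j * t ^ j) + f d' * t ^ d')"
      using pCons.prems f d' by simp
    also have "\<dots> = (a + f d' * t ^ d) + (\<Sum>j<d'. f j * t ^ Suc j)"
      by (simp add: d' distrib_left sum_distrib_left mult_ac)
    also have "\<dots> = (\<Sum>j<d. ?g j * t ^ j)"
      unfolding d' sum.lessThan_Suc_shift by simp
    finally show ?case
      using f(1) a t is_subfieldD(3,4)[OF C] d'
      by (intro exI[of _ ?g]) (auto split: nat.splits)
  qed
qed

text \<open>Translation by an element of N is invertible over N; this later identifies the field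
  generated by \<open>\<theta> n ^ (p ^ n)\<close> over N with N(Z2).\<close>

lemma gen_field_singleton_add:
  assumes "a \<in> N"
  shows "gen_field N {t + a} = gen_field N {t}"
proof -
  have "t + a \<in> gen_field N {t}" if "a \<in> N" for t a
    using gen_field_superset[of N "{t}"] gen_field_superset(2)[of "{t}" N] that
    by (intro is_subfieldD(3)[OF is_subfield_gen_field]) auto
  moreover have "t \<in> gen_field N {t + a}"
    using gen_field_superset(1)[of N "{t + a}"] gen_field_superset(2)[of "{t + a}" N] assms
      is_subfieldD(7)[OF is_subfield_gen_field, of "t + a" N "{t + a}" a] by auto
  ultimately show ?thesis
    using assms gen_field_superset(1)[of N "{t}"] gen_field_superset(1)[of N "{t + a}"]
    by (intro equalityI gen_field_least is_subfield_gen_field) simp_all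
qed

text \<open>Any two elements lie in a common member \<open>T (max m n)\<close>.\<close>

lemma is_subfield_UN_mono:
  assumes T: "\<And>n. is_subfield (T (n::nat))" and mono: "\<And>n. T n \<subseteq> T (Suc n)"
  shows "is_subfield (\<Union>n. T n)"
proof -
  have le: "T m \<subseteq> T n" if "m \<le> n" for m n
    using mono that by (rule lift_Suc_mono_le)
  have "x + y \<in> (\<Union>n. T n) \<and> x * y \<in> (\<Union>n. T n)" if "x \<in> T m" "y \<in> T n" for x y m n
    using le[of m "max m n"] le[of n "max m n"] that
      is_subfieldD(3,4)[OF T, of x "max m n" y] by auto
  moreover have "- x \<in> (\<Union>n. T n) \<and> inverse x \<in> (\<Union>n. T n)" if "x \<in> T n" for x n
    using is_subfieldD(5,6)[OF T that] by auto
  ultimately show ?thesis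
    using is_subfieldD(1,2)[OF T] unfolding is_subfield_def by (simp; blast)
qed

text \<open>Substituting \<open>[:a, 1:]\<close> keeps the coefficients in N, kills no nonzero
  polynomial, and turns a relation for t + a into one for t.\<close>

lemma transc_add:
  assumes N: "is_subfield N" and t: "transc N t" and a: "a \<in> N"
  shows "transc N (t + a)"
  unfolding transc_def
proof (intro ballI impI)
  fix q assume q: "q \<in> polys N" "poly q (t + a) = 0"
  note r = is_subring_if_is_subfield[OF N]
  have l: "[:a, 1:] \<in> polys N"
    using a is_subfieldD(1,2)[OF N] polys_pCons[OF r] polys_closed(1)[OF r] by auto
  have "pcompose q [:a, 1:] \<in> polys N"
    using q(1)
  proof (induction q)
    case (pCons b q)
    then have "[:b:] + [:a, 1:] * pcompose q [:a, 1:] \<in> polys N"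
      using l polys_pCons[OF r] polys_closed(1)[OF r]
      by (intro polys_closed(3,4)[OF r]) auto
    then show ?case by (simp add: pcompose_pCons)
  qed (simp add: polys_closed(1)[OF r])
  moreover have "poly (pcompose q [:a, 1:]) t = 0"
    using q(2) by (simp add: poly_pcompose add.commute)
  ultimately have "pcompose q [:a, 1:] = 0" by (rule transcD[OF t])
  then show "q = 0" by (simp add: pcompose_eq_0_iff)
qed

subsection \<open>Algebraic independence as iterated transcendence\<close>

lemma alg_indep3D:
  assumes "alg_indep3 k0 X Y Z" "\<And>i j l. c i j l \<in> k0"
    and "(\<Sum>i\<le>N. \<Sum>j\<le>N. \<Sum>l\<le>N. c i j l * X ^ i * Y ^ j * Z ^ l) = 0"
    and "i \<le> N" "j \<le> N" "l \<le> N"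
  shows "c i j l = 0"
  using assms(1)[unfolded alg_indep3_def, rule_format, of c N] assms(2-) by simp

lemma transc_alg_indep3_X:
  assumes k0: "is_subfield k0" and ind: "alg_indep3 k0 X Y Z"
  shows "transc k0 X"
  unfolding transc_def
proof (intro ballI impI)
  fix q assume q: "q \<in> polys k0" "poly q X = 0"
  \<comment> \<open>The coefficients of q sit at the exponents (i, 0, 0); the nested conditionals
    let \<open>sum.delta\<close> collapse the sums over l and j.\<close>
  define c where "c = (\<lambda>i j l::nat. if l = 0 then if j = (0::nat) then coeff q i else 0 else 0)"
  have "(\<Sum>i\<le>degree q. \<Sum>j\<le>degree q. \<Sum>l\<le>degree q. c i j l * X ^ i * Y ^ j * Z ^ l)
      = (\<Sum>i\<le>degree q. coeff q i * X ^ i)"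
    by (simp add: c_def if_distrib[of "\<lambda>x. x * _"] sum.delta cong: if_cong)
  also have "\<dots> = 0" using q(2) by (simp add: poly_altdef)
  finally have z: "(\<Sum>i\<le>degree q. \<Sum>j\<le>degree q. \<Sum>l\<le>degree q.
      c i j l * X ^ i * Y ^ j * Z ^ l) = 0" .
  have "c (degree q) 0 0 = 0"
    using polys_coeff[OF q(1)] is_subfieldD(1)[OF k0]
    by (intro alg_indep3D[OF ind _ z]) (auto simp: c_def)
  then show "q = 0" by (simp add: c_def)
qed

text \<open>Expanding the coefficients in k0[X] makes q(Y) a polynomial in X and Y over k0, that is,
  one in three variables without Z.\<close>

lemma transc_alg_indep3_Y:
  assumes k0: "is_subfield k0" and ind: "alg_indep3 k0 X Y Z"
  shows "transc (adjoin k0 X) Y"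
  unfolding transc_def
proof (intro ballI impI)
  fix q assume q: "q \<in> polys (adjoin k0 X)" "poly q Y = 0"
  have "\<forall>j. \<exists>r. r \<in> polys k0 \<and> coeff q j = poly r X"
    using polys_coeff[OF q(1)] unfolding adjoin_def by blast
  then obtain s where s: "\<And>j. s j \<in> polys k0" "\<And>j. coeff q j = poly (s j) X" by metis
  define N where "N = degree q + (\<Sum>j\<le>degree q. degree (s j))"
  \<comment> \<open>Above the degree of q, \<open>s j\<close> is only known to vanish at X and its
    degree is not covered by N, so its coefficients are replaced by zero.\<close>
  define c where
    "c = (\<lambda>i j l::nat. if l = 0 then if j \<le> degree q then coeff (s j) i else 0 else 0)"
  have N1: "degree q \<le> N" by (simp add: N_def)
  have N: "degree (s j) \<le> N" if "j \<le> degree q" for j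
    using member_le_sum[of j "{..degree q}" "\<lambda>j. degree (s j)"] that by (auto simp: N_def)
  have "(\<Sum>i\<le>N. \<Sum>j\<le>N. \<Sum>l\<le>N. c i j l * X ^ i * Y ^ j * Z ^ l)
      = (\<Sum>i\<le>N. \<Sum>j\<le>N. (if j \<le> degree q then coeff (s j) i else 0) * X ^ i * Y ^ j)"
    by (simp add: c_def if_distrib[of "\<lambda>x. x * _"] sum.delta cong: if_cong)
  also have "\<dots> = (\<Sum>j\<le>N. (\<Sum>i\<le>N. (if j \<le> degree q then coeff (s j) i else 0) * X ^ i) * Y ^ j)"
    unfolding sum_distrib_right by (rule sum.swap)
  also have "\<dots> = (\<Sum>j\<le>N. coeff q j * Y ^ j)"
  proof (intro sum.cong refl)
    fix j
    show "(\<Sum>i\<le>N. (if j \<le> degree q then coeff (s j) i else 0) * X ^ i) * Y ^ j = coeff q j * Y ^ j"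
      using poly_eq_sum_le[OF N, of j X] s(2)[of j]
      by (cases "j \<le> degree q") (simp_all add: coeff_eq_0)
  qed
  also have "\<dots> = 0" using poly_eq_sum_le[of q N Y] q(2) N1 by simp
  finally have z: "(\<Sum>i\<le>N. \<Sum>j\<le>N. \<Sum>l\<le>N. c i j l * X ^ i * Y ^ j * Z ^ l) = 0" .
  have c: "c i j l \<in> k0" for i j l
    using polys_coeff[OF s(1)] is_subfieldD(1)[OF k0] by (simp add: c_def)
  note c0 = alg_indep3D[OF ind c z]
  have "coeff q j = 0" if "j \<le> degree q" for j
  proof -
    have "coeff (s j) i = 0" if "i \<le> N" for i
      using c0[OF that, of j 0] \<open>j \<le> degree q\<close> N1 by (simp add: c_def)
    then show ?thesis using poly_eq_sum_le[OF N, of j X] that s(2)[of j] by simp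
  qed
  then show "q = 0" using leading_coeff_0_iff by blast
qed

text \<open>The expansion is given for every bound n beyond N, so that finitely many elements of
  k0[X][Y] can share one range of summation.\<close>

lemma adjoin_adjoinE:
  assumes k0: "is_subring k0" and r: "r \<in> adjoin (adjoin k0 X) Y"
  obtains s N where "\<And>i j. s i j \<in> k0"
    "\<And>n. N \<le> n \<Longrightarrow> r = (\<Sum>i\<le>n. \<Sum>j\<le>n. s i j * X ^ i * Y ^ j)"
proof -
  from r obtain q where q: "q \<in> polys (adjoin k0 X)" "r = poly q Y" by (auto simp: adjoin_def)
  have "\<forall>j. \<exists>r. r \<in> polys k0 \<and> coeff q j = poly r X"
    using polys_coeff[OF q(1)] unfolding adjoin_def by blast
  then obtain s where s: "\<And>j. s j \<in> polys k0" "\<And>j. coeff q j = poly (s j) X" by metis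
  define N where "N = degree q + (\<Sum>j\<le>degree q. degree (s j))"
  have N1: "degree q \<le> N" by (simp add: N_def)
  have N: "degree (s j) \<le> N" if "j \<le> degree q" for j
    using member_le_sum[of j "{..degree q}" "\<lambda>j. degree (s j)"] that by (auto simp: N_def)
  define c where "c = (\<lambda>i j. if j \<le> degree q then coeff (s j) i else 0)"
  show thesis
  proof (rule that)
    show "c i j \<in> k0" for i j
      using polys_coeff[OF s(1)] is_subringD(1)[OF k0] by (simp add: c_def)
    fix n assume n: "N \<le> n"
    have "(\<Sum>i\<le>n. \<Sum>j\<le>n. c i j * X ^ i * Y ^ j) = (\<Sum>j\<le>n. (\<Sum>i\<le>n. c i j * X ^ i) * Y ^ j)"
      unfolding sum_distrib_right by (rule sum.swap)
    also have "\<dots> = (\<Sum>j\<le>n. coeff q j * Y ^ j)"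
    proof (intro sum.cong refl)
      fix j
      show "(\<Sum>i\<le>n. c i j * X ^ i) * Y ^ j = coeff q j * Y ^ j"
        using poly_eq_sum_le[OF order_trans[OF N n], of j X] s(2)[of j]
        by (cases "j \<le> degree q") (simp_all add: coeff_eq_0 c_def)
    qed
    also have "\<dots> = r" using poly_eq_sum_le[of q n Y] q(2) N1 n by simp
    finally show "r = (\<Sum>i\<le>n. \<Sum>j\<le>n. c i j * X ^ i * Y ^ j)" by simp
  qed
qed

lemma transc_alg_indep3_Z:
  assumes k0: "is_subfield k0" and ind: "alg_indep3 k0 X Y Z"
  shows "transc (adjoin (adjoin k0 X) Y) Z"
  unfolding transc_def
proof (intro ballI impI)
  fix q assume q: "q \<in> polys (adjoin (adjoin k0 X) Y)" "poly q Z = 0"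
  have "\<forall>l. \<exists>s N. (\<forall>i j. s i j \<in> k0) \<and>
      (\<forall>n\<ge>N. coeff q l = (\<Sum>i\<le>n. \<Sum>j\<le>n. s i j * X ^ i * Y ^ j))"
  proof
    fix l
    show "\<exists>s N. (\<forall>i j. s i j \<in> k0) \<and>
        (\<forall>n\<ge>N. coeff q l = (\<Sum>i\<le>n. \<Sum>j\<le>n. s i j * X ^ i * Y ^ j))"
      by (rule adjoin_adjoinE[OF is_subring_if_is_subfield[OF k0] polys_coeff[OF q(1), of l]]) blast
  qed
  then obtain s where "\<forall>l. \<exists>N. (\<forall>i j. s l i j \<in> k0) \<and>
      (\<forall>n\<ge>N. coeff q l = (\<Sum>i\<le>n. \<Sum>j\<le>n. s l i j * X ^ i * Y ^ j))"
    by (rule choice[THEN exE])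
  then obtain e where "\<forall>l. (\<forall>i j. s l i j \<in> k0) \<and>
      (\<forall>n\<ge>e l. coeff q l = (\<Sum>i\<le>n. \<Sum>j\<le>n. s l i j * X ^ i * Y ^ j))"
    by (rule choice[THEN exE])
  then have s: "\<And>l i j. s l i j \<in> k0"
    "\<And>l n. e l \<le> n \<Longrightarrow> coeff q l = (\<Sum>i\<le>n. \<Sum>j\<le>n. s l i j * X ^ i * Y ^ j)"
    by blast+
  \<comment> \<open>Each coefficient has its own bound \<open>e j\<close>; their sum plus the degree
    of q bounds all three ranges.\<close>
  define N where "N = degree q + (\<Sum>j\<le>degree q. e j)"
  have N1: "degree q \<le> N" by (simp add: N_def)
  have N: "e j \<le> N" if "j \<le> degree q" for j
    using member_le_sum[of j "{..degree q}" e] that by (auto simp: N_def)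
  define c where "c = (\<lambda>i j l. if l \<le> degree q then s l i j else 0)"
  have "(\<Sum>i\<le>N. \<Sum>j\<le>N. \<Sum>l\<le>N. c i j l * X ^ i * Y ^ j * Z ^ l)
      = (\<Sum>i\<le>N. \<Sum>l\<le>N. \<Sum>j\<le>N. c i j l * X ^ i * Y ^ j * Z ^ l)"
    by (rule sum.cong[OF refl], rule sum.swap)
  also have "\<dots> = (\<Sum>l\<le>N. (\<Sum>i\<le>N. \<Sum>j\<le>N. c i j l * X ^ i * Y ^ j) * Z ^ l)"
    unfolding sum_distrib_right by (rule sum.swap)
  also have "\<dots> = (\<Sum>l\<le>N. coeff q l * Z ^ l)"
  proof (intro sum.cong refl)
    fix l
    show "(\<Sum>i\<le>N. \<Sum>j\<le>N. c i j l * X ^ i * Y ^ j) * Z ^ l = coeff q l * Z ^ l"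
      using s(2)[OF N, of l] by (cases "l \<le> degree q") (simp_all add: coeff_eq_0 c_def)
  qed
  also have "\<dots> = 0" using poly_eq_sum_le[of q N Z] q(2) N1 by simp
  finally have z: "(\<Sum>i\<le>N. \<Sum>j\<le>N. \<Sum>l\<le>N. c i j l * X ^ i * Y ^ j * Z ^ l) = 0" .
  have c: "c i j l \<in> k0" for i j l
    using s(1) is_subfieldD(1)[OF k0] by (simp add: c_def)
  note c0 = alg_indep3D[OF ind c z]
  have "coeff q l = 0" if "l \<le> degree q" for l
  proof -
    have "s l i j = 0" if "i \<le> N" "j \<le> N" for i j
      using c0[OF that, of l] \<open>l \<le> degree q\<close> N1 by (simp add: c_def)
    then show ?thesis using s(2)[OF N, of l] that by simp
  qed
  then show "q = 0" using leading_coeff_0_iff by blast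
qed

lemma transc_gen_field_alg_indep3:
  assumes k0: "is_subfield k0" and ind: "alg_indep3 k0 X Y Z"
  shows "transc (gen_field k0 {X}) Y" "transc (gen_field (gen_field k0 {X}) {Y}) Z"
proof -
  note r = is_subring_if_is_subfield[OF k0]
  note r1 = is_subring_adjoin[OF r, of X]
  show "transc (gen_field k0 {X}) Y"
    unfolding gen_field_singleton[OF k0]
    by (rule transc_fracs[OF r1 transc_alg_indep3_Y[OF assms]])
  show "transc (gen_field (gen_field k0 {X}) {Y}) Z"
    unfolding gen_field_singleton[OF k0] gen_field_fracs[OF r1]
    by (rule transc_fracs[OF is_subring_adjoin[OF r1] transc_alg_indep3_Z[OF assms]])
qed

subsection \<open>Linear disjointness\<close>

lemma lin_indepD:
  assumes "lin_indep F S" "\<And>s. s \<in> S \<Longrightarrow> c s \<in> F" "(\<Sum>s\<in>S. c s * s) = 0" "s \<in> S"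
  shows "c s = 0"
  using assms unfolding lin_indep_def by blast

text \<open>A relation with nonzero coefficient at w could be solved for w.\<close>

lemma lin_indep_insert:
  assumes C: "is_subfield C" and U: "finite U" "lin_indep C U" "w \<notin> U"
    and w: "\<And>\<gamma>. (\<forall>u\<in>U. \<gamma> u \<in> C) \<Longrightarrow> w \<noteq> (\<Sum>u\<in>U. \<gamma> u * u)"
  shows "lin_indep C (insert w U)"
  unfolding lin_indep_def
proof (intro allI impI)
  fix c assume *: "(\<forall>s\<in>insert w U. c s \<in> C) \<and> (\<Sum>s\<in>insert w U. c s * s) = 0"
  then have s: "c w * w + (\<Sum>s\<in>U. c s * s) = 0" using U by simp
  have "c w = 0"
  proof (rule ccontr)
    assume nz: "c w \<noteq> 0"
    have "c w * w = - (\<Sum>s\<in>U. c s * s)" using s by (simp add: eq_neg_iff_add_eq_0)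
    then have "w = (- (\<Sum>s\<in>U. c s * s)) / c w" using nz by (simp add: field_simps)
    also have "\<dots> = (\<Sum>s\<in>U. (- (c s / c w)) * s)"
      by (simp add: sum_divide_distrib sum_negf)
    finally show False
      using w[of "\<lambda>s. - (c s / c w)"] * is_subfieldD(5,8)[OF C] by auto
  qed
  moreover from this have "(\<Sum>s\<in>U. c s * s) = 0" using s by simp
  then have "c u = 0" if "u \<in> U" for u
    using * that by (intro lin_indepD[OF U(2), of c]) auto
  ultimately show "\<forall>s\<in>insert w U. c s = 0" by simp
qed

text \<open>Greedy choice: an element of W joins U exactly when it is outside the C-span of
  U.\<close>

lemma exists_basis:
  assumes C: "is_subfield C" and "finite W"
  obtains U where "U \<subseteq> W" "lin_indep C U"
    "\<And>w. w \<in> W \<Longrightarrow> \<exists>\<gamma>. (\<forall>u\<in>U. \<gamma> u \<in> C) \<and> w = (\<Sum>u\<in>U. \<gamma> u * u)"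
proof -
  have "\<exists>U\<subseteq>W. lin_indep C U \<and>
      (\<forall>w\<in>W. \<exists>\<gamma>. (\<forall>u\<in>U. \<gamma> u \<in> C) \<and> w = (\<Sum>u\<in>U. \<gamma> u * u))"
    using assms(2)
  proof (induction W rule: finite_induct)
    case empty
    then show ?case by (auto simp: lin_indep_def)
  next
    case (insert w W)
    then obtain U where U: "U \<subseteq> W" "lin_indep C U"
      "\<forall>w\<in>W. \<exists>\<gamma>. (\<forall>u\<in>U. \<gamma> u \<in> C) \<and> w = (\<Sum>u\<in>U. \<gamma> u * u)" by blast
    have fin: "finite U" using U(1) insert.hyps(1) by (rule finite_subset)
    have wU: "w \<notin> U" using U(1) insert.hyps(2) by auto
    show ?case
    proof (cases "\<exists>\<gamma>. (\<forall>u\<in>U. \<gamma> u \<in> C) \<and> w = (\<Sum>u\<in>U. \<gamma> u * u)")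
      case True
      then show ?thesis using U by (intro exI[of _ U]) auto
    next
      case False
      then have "lin_indep C (insert w U)" by (intro lin_indep_insert[OF C fin U(2) wU]) blast
      moreover have "\<exists>\<gamma>. (\<forall>u\<in>insert w U. \<gamma> u \<in> C) \<and> v = (\<Sum>u\<in>insert w U. \<gamma> u * u)"
        if v: "v \<in> insert w W" for v
      proof (cases "v = w")
        case True
        have "(\<Sum>u\<in>insert w U. (if u = w then 1 else 0) * u) = w"
          using fin wU by (simp add: if_distrib[of "\<lambda>x. x * _"] sum.delta cong: if_cong)
        then show ?thesis
          using True is_subfieldD(1,2)[OF C]
          by (intro exI[of _ "\<lambda>u. if u = w then 1 else 0"]) auto
      next
        case False
        with v U(3) obtain \<gamma> where g: "\<forall>u\<in>U. \<gamma> u \<in> C" "v = (\<Sum>u\<in>U. \<gamma> u * u)" by auto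
        have "(\<Sum>u\<in>insert w U. (if u = w then 0 else \<gamma> u) * u) = (\<Sum>u\<in>U. \<gamma> u * u)"
          using fin wU by (simp, intro sum.cong) auto
        then show ?thesis
          using g is_subfieldD(1)[OF C]
          by (intro exI[of _ "\<lambda>u. if u = w then 0 else \<gamma> u"]) auto
      qed
      ultimately show ?thesis using U(1) by (intro exI[of _ "insert w U"]) auto
    qed
  qed
  then show ?thesis using that by blast
qed

text \<open>The coefficients of a relation over A are expanded in a C-basis U of their span.
  Regrouped by U it becomes a relation over B, whose coefficients vanish because U stays independent
  over B. These are C-combinations of S, so independence of S kills every coordinate.\<close>

lemma lin_disjoint_sym:
  assumes C: "is_subfield C" and B: "is_subfield B" and "C \<subseteq> B"
    and d: "lin_disjoint C A B"
  shows "lin_disjoint C B A"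
  unfolding lin_disjoint_def
proof (intro allI impI)
  fix S assume S: "finite S \<and> S \<subseteq> B \<and> lin_indep C S"
  show "lin_indep A S"
    unfolding lin_indep_def
  proof (intro allI impI)
    fix c assume c: "(\<forall>s\<in>S. c s \<in> A) \<and> (\<Sum>s\<in>S. c s * s) = 0"
    obtain U where U: "U \<subseteq> c ` S" "lin_indep C U"
      "\<And>w. w \<in> c ` S \<Longrightarrow> \<exists>\<gamma>. (\<forall>u\<in>U. \<gamma> u \<in> C) \<and> w = (\<Sum>u\<in>U. \<gamma> u * u)"
      using exists_basis[OF C, of "c ` S"] S by auto
    have "\<forall>s. \<exists>\<gamma>. s \<in> S \<longrightarrow> (\<forall>u\<in>U. \<gamma> u \<in> C) \<and> c s = (\<Sum>u\<in>U. \<gamma> u * u)"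
      using U(3) by blast
    then obtain \<gamma> where g: "\<And>s. s \<in> S \<Longrightarrow> (\<forall>u\<in>U. \<gamma> s u \<in> C) \<and> c s = (\<Sum>u\<in>U. \<gamma> s u * u)"
      by metis
    have UB: "lin_indep B U"
      using d U(1,2) c S finite_subset[OF U(1)] unfolding lin_disjoint_def by blast
    have "(\<Sum>u\<in>U. (\<Sum>s\<in>S. \<gamma> s u * s) * u) = (\<Sum>s\<in>S. \<Sum>u\<in>U. \<gamma> s u * u * s)"
      unfolding sum_distrib_right by (subst sum.swap) (simp add: mult_ac)
    also have "\<dots> = (\<Sum>s\<in>S. c s * s)"
      using g by (simp add: sum_distrib_right)
    finally have z: "(\<Sum>u\<in>U. (\<Sum>s\<in>S. \<gamma> s u * s) * u) = 0" using c by simp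
    have "(\<Sum>s\<in>S. \<gamma> s u * s) \<in> B" if "u \<in> U" for u
    proof (rule is_subring_sum[OF is_subring_if_is_subfield[OF B]])
      fix s assume "s \<in> S"
      then show "\<gamma> s u * s \<in> B"
        using g that S \<open>C \<subseteq> B\<close> by (intro is_subfieldD(4)[OF B]) auto
    qed
    then have z': "(\<Sum>s\<in>S. \<gamma> s u * s) = 0" if "u \<in> U" for u
      using that z by (intro lin_indepD[OF UB, of "\<lambda>u. \<Sum>s\<in>S. \<gamma> s u * s"]) auto
    have "\<gamma> s u = 0" if "s \<in> S" "u \<in> U" for s u
      using that g S z'[OF that(2)] by (intro lin_indepD[of C S "\<lambda>s. \<gamma> s u"]) auto
    then show "\<forall>s\<in>S. c s = 0" using g by simp
  qed
qed

text \<open>The family t takes the place of U in the exchange argument of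
  \<open>lin_disjoint_sym\<close>. It may depend on S because K will be a union of fields, each with
  its own basis of powers.\<close>

lemma lin_disjoint_if_common_basis:
  assumes M: "is_subfield M" and "C \<subseteq> M"
    and span: "\<And>S. finite S \<Longrightarrow> S \<subseteq> A \<Longrightarrow> \<exists>t d.
      (\<forall>c. (\<forall>j<d. c j \<in> M) \<and> (\<Sum>j<d. c j * t j) = 0 \<longrightarrow> (\<forall>j<d. c j = 0)) \<and>
      (\<forall>s\<in>S. \<exists>f. (\<forall>j<(d::nat). f j \<in> C) \<and> s = (\<Sum>j<d. f j * t j))"
  shows "lin_disjoint C M A"
  unfolding lin_disjoint_def
proof (intro allI impI)
  fix U assume U: "finite U \<and> U \<subseteq> M \<and> lin_indep C U"
  show "lin_indep A U"
    unfolding lin_indep_def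
  proof (intro allI impI)
    fix y assume y: "(\<forall>u\<in>U. y u \<in> A) \<and> (\<Sum>u\<in>U. y u * u) = 0"
    then obtain t and d :: nat where
      t: "\<And>c j. \<forall>j<d. c j \<in> M \<Longrightarrow> (\<Sum>j<d. c j * t j) = 0 \<Longrightarrow> j < d \<Longrightarrow> c j = 0" and
      sp: "\<forall>s\<in>y ` U. \<exists>f. (\<forall>j<d. f j \<in> C) \<and> s = (\<Sum>j<d. f j * t j)"
      using span[of "y ` U"] U by blast
    have "\<forall>u. \<exists>f. u \<in> U \<longrightarrow> (\<forall>j<d. f j \<in> C) \<and> y u = (\<Sum>j<d. f j * t j)"
      using sp by blast
    then obtain f where f: "\<And>u. u \<in> U \<Longrightarrow> (\<forall>j<d. f u j \<in> C) \<and> y u = (\<Sum>j<d. f u j * t j)"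
      by metis
    have "(\<Sum>j<d. (\<Sum>u\<in>U. f u j * u) * t j) = (\<Sum>u\<in>U. \<Sum>j<d. f u j * t j * u)"
      unfolding sum_distrib_right by (subst sum.swap) (simp add: mult_ac)
    also have "\<dots> = (\<Sum>u\<in>U. y u * u)" using f by (simp add: sum_distrib_right)
    finally have z: "(\<Sum>j<d. (\<Sum>u\<in>U. f u j * u) * t j) = 0" using y by simp
    have "(\<Sum>u\<in>U. f u j * u) \<in> M" if "j < d" for j
      using f that U \<open>C \<subseteq> M\<close>
      by (intro is_subring_sum[OF is_subring_if_is_subfield[OF M]] is_subfieldD(4)[OF M]) auto
    then have z': "(\<Sum>u\<in>U. f u j * u) = 0" if "j < d" for j
      using that z by (intro t[of "\<lambda>j. \<Sum>u\<in>U. f u j * u"]) auto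
    have "f u j = 0" if "u \<in> U" "j < d" for u j
      using that f U z'[OF that(2)] by (intro lin_indepD[of C U "\<lambda>u. f u j"]) auto
    then show "\<forall>u\<in>U. y u = 0" using f by simp
  qed
qed

text \<open>As b is outside C, the elements 1 and b are independent over C. Were c outside their
  C-span, then 1, b, c would stay independent over M, against the relation
  \<open>dep\<close>.\<close>

lemma lin_disjoint_one_dependent:
  assumes C: "is_subfield C" and M: "is_subfield M" and d: "lin_disjoint C A M"
    and mem: "1 \<in> A" "b \<in> A" "c \<in> A" and dep: "\<mu> \<in> M" "\<nu> \<in> M" "c = \<mu> + \<nu> * b"
    and b: "b \<notin> C"
  obtains \<alpha> \<beta> where "\<alpha> \<in> C" "\<beta> \<in> C" "c = \<alpha> + \<beta> * b"
proof -
  note z = is_subfieldD(1,2)[OF C]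
  have b1: "b \<noteq> 1" "b \<noteq> 0" using b z by auto
  have ind1: "lin_indep C {1}"
    by (simp add: lin_indep_def)
  have ind2: "lin_indep C {b, 1}"
    using b b1 is_subfieldD(4)[OF C]
    by (intro lin_indep_insert[OF C _ ind1]) auto
  show thesis
  proof (cases "\<exists>\<alpha>\<in>C. \<exists>\<beta>\<in>C. c = \<alpha> + \<beta> * b")
    case True
    then show ?thesis using that by blast
  next
    case False
    have "c \<noteq> 1 + 0 * b" "c \<noteq> 0 + 1 * b" using False z by blast+
    then have cn: "c \<noteq> 1" "c \<noteq> b" by simp_all
    have "c \<noteq> (\<Sum>u\<in>{b, 1}. \<gamma> u * u)" if "\<forall>u\<in>{b, 1}. \<gamma> u \<in> C" for \<gamma>
    proof
      assume "c = (\<Sum>u\<in>{b, 1}. \<gamma> u * u)"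
      then have "c = \<gamma> 1 + \<gamma> b * b" using b1 by (simp add: add.commute)
      then show False using False that by blast
    qed
    then have "lin_indep C {c, b, 1}"
      using cn by (intro lin_indep_insert[OF C _ ind2]) auto
    then have ind3: "lin_indep M {c, b, 1}"
      using d mem unfolding lin_disjoint_def by simp
    \<comment> \<open>The relation c - \<nu> b - \<mu> = 0; its coefficient 1 at c gives the
      contradiction.\<close>
    define g where "g = (\<lambda>u. if u = c then 1 else if u = b then - \<nu> else - \<mu>)"
    have g: "g c = 1" "g b = - \<nu>" "g 1 = - \<mu>" using cn b1 by (auto simp: g_def)
    have sum0: "(\<Sum>s\<in>{c, b, 1}. g s * s) = 0"
    proof -
      have "(\<Sum>s\<in>{c, b, 1}. g s * s) = c - (\<mu> + \<nu> * b)" using cn b1 g by simp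
      then show ?thesis unfolding dep(3)[symmetric] by simp
    qed
    have gM: "g s \<in> M" if "s \<in> {c, b, 1}" for s
      using that g is_subfieldD(2)[OF M] is_subfieldD(5)[OF M dep(1)]
        is_subfieldD(5)[OF M dep(2)] by auto
    have "g c = 0" by (rule lin_indepD[OF ind3 gM sum0]) simp_all
    then show ?thesis using g by simp
  qed
qed

subsection \<open>Fields of prime characteristic\<close>

locale char_p =
  fixes p :: nat and TYPEa :: "'a::field itself"
  assumes prime_p: "prime p" and of_nat_p: "of_nat p = (0::'a)"
begin

lemma char_eq: "CHAR('a) = p"
proof -
  have "CHAR('a) dvd p" using of_nat_p by (simp add: of_nat_eq_0_iff_char_dvd)
  then show ?thesis using prime_p CHAR_not_1' by (metis One_nat_def prime_nat_iff)
qed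

lemma p_pos: "p ^ n > 0" "p > 1"
  using prime_p prime_gt_1_nat by (auto simp: prime_gt_0_nat)

lemma frob_add: "(x + y :: 'a) ^ (p ^ n) = x ^ (p ^ n) + y ^ (p ^ n)"
  using freshmans_dream'[of "p ^ n" n x y] prime_p by (simp add: char_eq)

lemma frob_sum: "sum f I ^ (p ^ n) = (\<Sum>i\<in>I. f i ^ (p ^ n) :: 'a)"
  using freshmans_dream_sum'[of "p ^ n" n f I] prime_p by (simp add: char_eq)

lemma frob_uminus: "(- x :: 'a) ^ (p ^ n) = - (x ^ (p ^ n))"
  using frob_add[of x "- x" n] p_pos(1)[of n]
  by (metis add.right_inverse add_eq_0_iff power_0_left less_numeral_extra(3))

lemma frob_diff: "(x - y :: 'a) ^ (p ^ n) = x ^ (p ^ n) - y ^ (p ^ n)"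
  using frob_add[of x "- y" n] by (simp add: frob_uminus)

lemma frob_inj: "(x :: 'a) ^ (p ^ n) = y ^ (p ^ n) \<longleftrightarrow> x = y"
  using frob_diff[of x y n] by auto

section \<open>Subfields and Frobenius powers\<close>

lemma is_subfield_frob_vimage:
  assumes F: "is_subfield (F :: 'a set)"
  shows "is_subfield {x. x ^ (p ^ n) \<in> F}"
  unfolding is_subfield_def using is_subfieldD(1-6)[OF F] p_pos
  by (auto simp: frob_add frob_uminus power_mult_distrib power_inverse power_0_left)

text \<open>Two elements with exponents m and n share the exponent m + n, which reduces the claim to
  a single Frobenius preimage.\<close>

lemma is_subfield_radical_closure:
  assumes F: "is_subfield (F :: 'a set)"
  shows "is_subfield {x. \<exists>n. x ^ (p ^ n) \<in> F}"
proof -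
  note S = is_subfield_frob_vimage[OF F]
  have up: "x ^ (p ^ (m + n)) \<in> F" if "x ^ (p ^ m) \<in> F" for x m n
    using is_subring_power[OF is_subring_if_is_subfield[OF F] that, of "p ^ n"]
    by (simp add: power_add power_mult)
  have "x + y \<in> {x. \<exists>n. x ^ (p ^ n) \<in> F} \<and> x * y \<in> {x. \<exists>n. x ^ (p ^ n) \<in> F}"
    if "x ^ (p ^ m) \<in> F" "y ^ (p ^ n) \<in> F" for x y m n
    using is_subfieldD(3,4)[OF S, of x "m + n" y] up[OF that(1), of n] up[OF that(2), of m]
    by (auto simp: add.commute[of n m])
  moreover have "- x \<in> {x. \<exists>n. x ^ (p ^ n) \<in> F} \<and> inverse x \<in> {x. \<exists>n. x ^ (p ^ n) \<in> F}"
    if "x ^ (p ^ n) \<in> F" for x n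
    using is_subfieldD(5,6)[OF S, of x n] that by auto
  moreover have "\<exists>n. 0 ^ (p ^ n) \<in> F" "\<exists>n. 1 ^ (p ^ n) \<in> F"
    using is_subfieldD(1,2)[OF S, of 0] by blast+
  ultimately show ?thesis unfolding is_subfield_def by simp blast
qed

lemma is_subfield_ppow_set:
  assumes F: "is_subfield (F :: 'a set)"
  shows "is_subfield (ppow_set p n F)"
proof -
  note f = is_subfieldD(1-6)[OF F]
  have "x ^ p ^ n + y ^ p ^ n \<in> ppow_set p n F" "x ^ p ^ n * y ^ p ^ n \<in> ppow_set p n F"
    if "x \<in> F" "y \<in> F" for x y
    unfolding ppow_set_def
    using that f(3,4)[of x y] by (auto simp flip: frob_add power_mult_distrib)
  moreover have "- (x ^ p ^ n) \<in> ppow_set p n F" "inverse (x ^ p ^ n) \<in> ppow_set p n F"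
    if "x \<in> F" for x
    unfolding ppow_set_def
    using that f(5,6)[of x] by (auto simp flip: frob_uminus power_inverse)
  moreover have "0 \<in> ppow_set p n F" "1 \<in> ppow_set p n F"
    unfolding ppow_set_def using f(1,2) p_pos(1)[of n]
    by (auto intro!: image_eqI[of _ _ 0] image_eqI[of _ _ 1])
  ultimately show ?thesis
    unfolding is_subfield_def by (auto simp: ppow_set_def)
qed

text \<open>Raising q(t) = 0 to a large power p^r moves all coefficients into F at once and,
  Frobenius being additive, leaves a relation with exponents \<open>i * p ^ r\<close>.\<close>

lemma transc_radical_closure:
  assumes F: "is_subfield (F :: 'a set)" and t: "transc F t"
    and E: "E \<subseteq> {x. \<exists>n. x ^ (p ^ n) \<in> F}"
  shows "transc E t"
  unfolding transc_def
proof (intro ballI impI)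
  fix q assume q: "q \<in> polys E" "poly q t = 0"
  have "\<forall>i. \<exists>n. coeff q i ^ (p ^ n) \<in> F" using q(1) E by (auto simp: polys_def)
  then obtain e where e: "\<And>i. coeff q i ^ (p ^ e i) \<in> F" by metis
  define r where "r = (\<Sum>i\<le>degree q. e i)"
  have c: "coeff q i ^ (p ^ r) \<in> F" if "i \<le> degree q" for i
  proof -
    have "e i \<le> r" unfolding r_def using that by (intro member_le_sum) auto
    then obtain m where "r = e i + m" using le_Suc_ex by blast
    then show ?thesis
      using is_subring_power[OF is_subring_if_is_subfield[OF F] e, of i "p ^ m"]
      by (simp add: power_add power_mult)
  qed
  let ?Q = "\<Sum>i\<le>degree q. monom (coeff q i ^ (p ^ r)) (i * p ^ r)"
  have "?Q \<in> polys F"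
    using c by (intro polys_sum polys_closed is_subring_if_is_subfield F) auto
  moreover have "poly ?Q t = poly q t ^ (p ^ r)"
    by (simp add: poly_sum poly_monom poly_altdef[of q] frob_sum power_mult_distrib power_mult)
  ultimately have Q: "?Q = 0" using q(2) p_pos by (intro transcD[OF t]) (auto simp: power_0_left)
  have "coeff q n = 0" for n
  proof (cases "n \<le> degree q")
    case True
    have "coeff ?Q (n * p ^ r) = (\<Sum>i\<le>degree q. if i = n then coeff q n ^ (p ^ r) else 0)"
      unfolding coeff_sum coeff_monom using p_pos(1)[of r] by (intro sum.cong) auto
    then show ?thesis using True Q by simp
  qed (simp add: coeff_eq_0)
  then show "q = 0" by (simp add: poly_eq_iff)
qed

lemma is_subfield_adjoin:
  assumes C: "is_subfield (C :: 'a set)" and t: "t ^ (p ^ n) \<in> C"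
  shows "is_subfield (adjoin C t)"
proof -
  note cr = is_subring_if_is_subfield[OF C]
  note ar = is_subring_adjoin[OF cr, of t]
  note sup = adjoin_superset[OF cr, of t]
  have pow: "adjoin C t \<subseteq> {x. x ^ (p ^ n) \<in> C}"
    using is_subfield_frob_vimage[OF C, of n] t is_subring_power[OF cr]
    by (intro adjoin_least is_subring_if_is_subfield) auto
  \<comment> \<open>The \<open>p ^ n\<close>-th power of an element of \<open>C[t]\<close> is a scalar, which gives inverses.\<close>
  have "inverse x \<in> adjoin C t" if x: "x \<in> adjoin C t" for x
  proof (cases "x = 0")
    case False
    have "inverse x = x ^ (p ^ n - 1) * inverse (x ^ (p ^ n))"
      using False p_pos(1)[of n] by (cases "p ^ n") (auto simp: field_simps)
    moreover have "inverse (x ^ (p ^ n)) \<in> adjoin C t"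
      using pow x is_subfieldD(6)[OF C] sup by auto
    ultimately show ?thesis using is_subring_power[OF ar x] is_subringD(4)[OF ar] by metis
  qed (use x in simp)
  then show ?thesis using ar unfolding is_subfield_def is_subring_def by simp
qed

text \<open>This lets a p-th root descend through a tower of simple transcendental extensions, one
  variable at a time. Transcendence of w turns y = P(w)/Q(w) into a polynomial identity between
  \<open>P ^ p\<close> and a multiple of \<open>Q ^ p\<close>.\<close>

lemma root_mem_of_transc:
  assumes N: "is_subfield (N :: 'a set)" and w: "transc N w"
    and y: "y \<in> gen_field N {w}" "y ^ p \<in> N"
  shows "y \<in> N"
proof -
  note r = is_subring_if_is_subfield[OF N]
  from y(1) obtain P Q where PQ: "P \<in> polys N" "Q \<in> polys N" "poly Q w \<noteq> 0"
      "y = poly P w / poly Q w"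
    unfolding gen_field_singleton[OF N] by (auto elim!: fracsE simp: adjoin_def)
  have "poly P w = y * poly Q w" using PQ by simp
  then have "poly (P ^ p - smult (y ^ p) (Q ^ p)) w = 0"
    by (simp add: power_mult_distrib)
  moreover have "P ^ p - smult (y ^ p) (Q ^ p) \<in> polys N"
    using PQ y(2) by (intro polys_closed[OF r])
  ultimately have "P ^ p = smult (y ^ p) (Q ^ p)"
    using transcD[OF w] by fastforce
  \<comment> \<open>Comparing leading coefficients exhibits the \<open>p\<close>-th root of \<open>y ^ p\<close> inside \<open>N\<close>.\<close>
  then have "lead_coeff P ^ p = (y * lead_coeff Q) ^ p"
    by (metis lead_coeff_power lead_coeff_smult power_mult_distrib)
  then have "lead_coeff P = y * lead_coeff Q"
    using frob_inj[of _ 1] by simp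
  moreover have "lead_coeff Q \<noteq> 0" using PQ by auto
  ultimately have "y = lead_coeff P / lead_coeff Q" by simp
  then show ?thesis using PQ(1,2) is_subfieldD(8)[OF N] by (simp add: polys_def)
qed

text \<open>For y = P(z)/Q(z) a root would give the polynomial identity
  \<open>P ^ p = monom 1 1 * Q ^ p\<close>, whose two degrees differ modulo p.\<close>

lemma transc_not_power:
  assumes E: "is_subfield (E :: 'a set)" and z: "transc E z" and y: "y \<in> gen_field E {z}"
  shows "y ^ p \<noteq> z"
proof
  assume yz: "y ^ p = z"
  note r = is_subring_if_is_subfield[OF E]
  from y obtain P Q where PQ: "P \<in> polys E" "Q \<in> polys E" "poly Q z \<noteq> 0"
      "y = poly P z / poly Q z"
    unfolding gen_field_singleton[OF E] by (auto elim!: fracsE simp: adjoin_def)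
  have "poly P z = y * poly Q z" using PQ by simp
  then have "poly (P ^ p - monom 1 1 * Q ^ p) z = 0"
    by (simp add: power_mult_distrib poly_monom yz)
  moreover have "P ^ p - monom 1 1 * Q ^ p \<in> polys E"
    using PQ is_subringD(2)[OF r] by (intro polys_closed[OF r])
  ultimately have eq: "P ^ p = monom 1 1 * Q ^ p"
    using transcD[OF z] by fastforce
  have Q: "Q \<noteq> 0" using PQ by auto
  have "monom 1 1 * Q ^ p \<noteq> 0" using Q by simp
  then have P: "P \<noteq> 0" using eq p_pos(2) by (auto simp: power_0_left)
  have "p * degree P = 1 + p * degree Q"
    using arg_cong[OF eq, of degree] P Q
    by (simp add: degree_power_eq degree_mult_eq degree_monom_eq)
  then have "p dvd 1" by (metis dvd_add_left_iff dvd_triv_left)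
  then show False using p_pos(2) by simp
qed

text \<open>Frobenius is applied to the coefficients of q alone; the new polynomial takes the value
  \<open>poly q t ^ (p ^ n)\<close> at \<open>t ^ (p ^ n)\<close>.\<close>

lemma transc_of_power:
  assumes F: "is_subfield (F :: 'a set)" and t: "transc F (t ^ (p ^ n))"
  shows "transc F t"
  unfolding transc_def
proof (intro ballI impI)
  fix q assume q: "q \<in> polys F" "poly q t = 0"
  let ?Q = "map_poly (\<lambda>c. c ^ (p ^ n)) q"
  have c: "coeff ?Q i = coeff q i ^ (p ^ n)" for i
    using p_pos(1)[of n] by (simp add: coeff_map_poly power_0_left)
  have deg: "degree ?Q = degree q"
    using p_pos(1)[of n] by (intro degree_map_poly) auto
  have "?Q \<in> polys F"
    using q(1) is_subring_power[OF is_subring_if_is_subfield[OF F]] by (simp add: polys_def c)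
  moreover have "poly ?Q (t ^ (p ^ n)) = poly q t ^ (p ^ n)"
    by (simp add: poly_altdef deg c frob_sum power_mult_distrib mult.commute flip: power_mult)
  ultimately have "?Q = 0" using q(2) p_pos(1)[of n]
    by (intro transcD[OF t]) (auto simp: power_0_left)
  then have "coeff q i = 0" for i using c[of i] p_pos(1)[of n] by simp
  then show "q = 0" by (simp add: poly_eq_iff)
qed

text \<open>A finite spanning set has a common exponent, and by additivity of Frobenius it serves
  every linear combination.\<close>

lemma fin_dim_bounded_exponent:
  assumes k: "is_subfield (k :: 'a set)" and L: "fin_dim k L" "L \<subseteq> K"
    and pi: "purely_insep p k K"
  obtains e where "\<And>y. y \<in> L \<Longrightarrow> y ^ (p ^ e) \<in> k"
proof -
  from L(1) obtain S where S: "finite S" "S \<subseteq> L"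
      "L = {y. \<exists>c. (\<forall>s\<in>S. c s \<in> k) \<and> y = (\<Sum>s\<in>S. c s * s)}"
    unfolding fin_dim_def by blast
  have "\<forall>s. \<exists>n. s \<in> S \<longrightarrow> s ^ (p ^ n) \<in> k"
    using pi S(2) L(2) unfolding purely_insep_def by blast
  then obtain n where n: "\<And>s. s \<in> S \<Longrightarrow> s ^ (p ^ n s) \<in> k" by metis
  define e where "e = (\<Sum>s\<in>S. n s)"
  note kr = is_subring_if_is_subfield[OF k]
  have e: "s ^ (p ^ e) \<in> k" if "s \<in> S" for s
  proof -
    have "n s \<le> e" unfolding e_def using that S(1) by (intro member_le_sum) auto
    then obtain d where "e = n s + d" using le_Suc_ex by blast
    then show ?thesis
      using is_subring_power[OF kr n[OF that], of "p ^ d"] by (simp add: power_add power_mult)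
  qed
  show thesis
  proof (rule that[of e])
    fix y assume "y \<in> L"
    then obtain c where c: "\<forall>s\<in>S. c s \<in> k" "y = (\<Sum>s\<in>S. c s * s)" using S(3) by blast
    show "y ^ (p ^ e) \<in> k"
      unfolding c(2) frob_sum power_mult_distrib using c(1)
      by (intro is_subring_sum[OF kr] is_subfieldD(4)[OF k _ e] is_subring_power[OF kr]) auto
  qed
qed

end

section \<open>Roots in a perfect field\<close>

locale perfect_char_p = char_p p TYPEa for p and TYPEa :: "'a::field itself" +
  assumes perfect: "\<exists>y. y ^ p = (x::'a)"
begin

lemma proot_eqI: "y ^ (p ^ n) = (x::'a) \<Longrightarrow> proot p n x = y"
  unfolding proot_def using frob_inj by (intro the_equality) auto

lemma exists_root: "\<exists>y. y ^ (p ^ n) = (x::'a)"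
proof (induction n arbitrary: x)
  case (Suc n)
  obtain y where "y ^ p = x" using perfect by blast
  moreover obtain w where "w ^ (p ^ n) = y" using Suc by blast
  ultimately have "w ^ (p ^ Suc n) = x" by (simp add: power_mult mult.commute[of p])
  then show ?case by blast
qed simp

lemma proot_power: "proot p n x ^ (p ^ n) = (x::'a)"
proof -
  obtain y where y: "y ^ (p ^ n) = x" using exists_root by blast
  then show ?thesis using proot_eqI[OF y] by simp
qed

lemma proot_0: "proot p 0 x = (x::'a)"
  by (rule proot_eqI) simp

lemma proot_add_power: "proot p (m + n) x ^ (p ^ m) = proot p n (x::'a)"
  by (rule proot_eqI[symmetric])
    (simp add: proot_power flip: power_mult power_add)

end

subsection \<open>The tower generated by the \<theta>\<close>

locale theta_tower = perfect_char_p p TYPEa for p and TYPEa :: "'a::field itself" +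
  fixes k0 :: "'a set" and X Z1 Z2 :: 'a
  assumes k0: "is_subfield k0" and indep: "alg_indep3 k0 X Z1 Z2"
begin

abbreviation "\<xi> n \<equiv> proot p n X"
abbreviation "\<theta> n \<equiv> theta p X Z1 Z2 n"

definition "E = gen_field k0 (range (\<lambda>n. \<xi> n))"
definition "N = gen_field E {Z1}"
definition "M = gen_field N {Z2}"
text \<open>Adjoining \<open>\<theta> n\<close> to N instead of k makes each level a simple
  transcendental extension; the union will agree with that of the \<open>Kn n\<close>.\<close>

definition "T n = gen_field N {\<theta> n}"
definition "K = (\<Union>n. T n)"

lemma subfields: "is_subfield E" "is_subfield N" "is_subfield M" "is_subfield (T n)"
  by (simp_all add: E_def N_def M_def T_def is_subfield_gen_field)

lemma subset_E: "k0 \<subseteq> E" "\<xi> n \<in> E"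
  using gen_field_superset[of k0 "range \<xi>"] gen_field_superset(2)[of "range \<xi>" k0]
  by (auto simp: E_def)

lemma subset_N: "E \<subseteq> N" "Z1 \<in> N" "\<xi> n \<in> N"
  using gen_field_superset(1)[of E "{Z1}"] gen_field_superset(2)[of "{Z1}" E] subset_E
  by (auto simp: N_def)

lemma subset_M: "N \<subseteq> M" "Z2 \<in> M"
  using gen_field_superset(1)[of N "{Z2}"] gen_field_superset(2)[of "{Z2}" N]
  by (auto simp: M_def)

lemma subset_T: "N \<subseteq> T n" "\<theta> n \<in> T n"
  using gen_field_superset(1)[of N "{\<theta> n}"] gen_field_superset(2)[of "{\<theta> n}" N]
  by (auto simp: T_def)

lemma theta_Suc_power: "\<theta> (Suc n) ^ p = Z1 * \<xi> (Suc (2 * n)) + \<theta> n"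
proof -
  have "\<xi> (2 * Suc n) ^ p = \<xi> (Suc (2 * n))"
    using proot_add_power[of 1 "Suc (2 * n)" X] by simp
  then show ?thesis
    using frob_add[of _ _ 1] proot_power[of 1] by (simp add: power_mult_distrib)
qed

lemma theta_Suc_power_power:
  "\<theta> (Suc n) ^ (p ^ Suc m) = (Z1 * \<xi> (Suc (2 * n))) ^ (p ^ m) + \<theta> n ^ (p ^ m)"
  by (simp only: power_Suc power_mult theta_Suc_power frob_add)

text \<open>Each p-th power lowers the index of \<theta> by one at the cost of a summand in N, and N
  is closed under further powers. The case n = 0 compares with Z2.\<close>

lemma theta_power_mod_N: "\<exists>a\<in>N. \<theta> (n + i) ^ (p ^ i) = \<theta> n + a"
proof (induction i)
  case 0
  show ?case using is_subfieldD(1)[OF subfields(2)] by (intro bexI[of _ 0]) simp_all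
next
  case (Suc i)
  then obtain a where a: "a \<in> N" "\<theta> (n + i) ^ (p ^ i) = \<theta> n + a" by blast
  have "(Z1 * \<xi> (Suc (2 * (n + i)))) ^ (p ^ i) \<in> N"
    using subset_N is_subfieldD(4)[OF subfields(2)]
    by (intro is_subring_power is_subring_if_is_subfield subfields) auto
  then have "a + (Z1 * \<xi> (Suc (2 * (n + i)))) ^ (p ^ i) \<in> N"
    using a is_subfieldD(3)[OF subfields(2)] by auto
  moreover have "\<theta> (n + Suc i) ^ (p ^ Suc i)
      = \<theta> n + (a + (Z1 * \<xi> (Suc (2 * (n + i)))) ^ (p ^ i))"
    using theta_Suc_power_power[of "n + i" i] a(2) by (simp only: add_Suc_right add_ac)
  ultimately show ?case by blast
qed

text \<open>The recursion, solved for \<open>\<theta> n\<close>, expresses it by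
  \<open>\<theta> (Suc n)\<close> and an element of N.\<close>

lemma T_mono: "m \<le> n \<Longrightarrow> T m \<subseteq> T n"
proof (rule lift_Suc_mono_le[of T])
  fix n
  have "\<theta> n = \<theta> (Suc n) ^ p - Z1 * \<xi> (Suc (2 * n))"
    using theta_Suc_power[of n] by simp
  moreover have "\<theta> (Suc n) ^ p \<in> T (Suc n)"
    by (intro is_subring_power is_subring_if_is_subfield subfields subset_T)
  moreover have "Z1 * \<xi> (Suc (2 * n)) \<in> T (Suc n)"
    using subset_T(1) subset_N by (intro is_subfieldD(4)[OF subfields(4)]) auto
  ultimately have "\<theta> n \<in> T (Suc n)"
    using is_subfieldD(7)[OF subfields(4)] by metis
  then show "T n \<subseteq> T (Suc n)"
    unfolding T_def[of n] using subset_T(1) by (intro gen_field_least subfields) auto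
qed

lemma is_subfield_K: "is_subfield K"
  unfolding K_def by (intro is_subfield_UN_mono subfields T_mono) simp

lemma T_0: "T 0 = M"
  by (simp add: T_def M_def)

lemma M_subset_K: "M \<subseteq> K"
  using T_0 by (auto simp: K_def)

lemma gen_field_theta_power: "gen_field N {\<theta> n ^ (p ^ n)} = M"
  using theta_power_mod_N[of 0 n] by (auto simp: M_def gen_field_singleton_add)

section \<open>Transcendence over the infinite extensions E and N\<close>

lemma k0_X_subfield: "is_subfield (gen_field k0 {X})"
  by (rule is_subfield_gen_field)

text \<open>Independence yields transcendence over k0(X) only; \<open>transc_radical_closure\<close>
  carries it up to E.\<close>

lemma E_radical: "E \<subseteq> {y. \<exists>n. y ^ (p ^ n) \<in> gen_field k0 {X}}"
proof -
  have "X \<in> gen_field k0 {X}" using gen_field_superset(2)[of "{X}" k0] by simp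
  then have "\<exists>m. \<xi> n ^ (p ^ m) \<in> gen_field k0 {X}" for n
    by (intro exI[of _ n]) (simp add: proot_power)
  moreover have "\<exists>m. y ^ (p ^ m) \<in> gen_field k0 {X}" if "y \<in> k0" for y
    using that gen_field_superset(1)[of k0 "{X}"] by (intro exI[of _ 0]) auto
  ultimately show ?thesis
    unfolding E_def by (intro gen_field_least is_subfield_radical_closure k0_X_subfield) auto
qed

lemma N_radical: "N \<subseteq> {y. \<exists>n. y ^ (p ^ n) \<in> gen_field (gen_field k0 {X}) {Z1}}"
proof -
  let ?F = "gen_field (gen_field k0 {X}) {Z1}"
  have "Z1 ^ (p ^ 0) \<in> ?F" using gen_field_superset(2)[of "{Z1}"] by simp
  then have "\<exists>n. Z1 ^ (p ^ n) \<in> ?F" by blast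
  moreover have "E \<subseteq> {y. \<exists>n. y ^ (p ^ n) \<in> ?F}"
    using E_radical gen_field_superset(1)[of "gen_field k0 {X}" "{Z1}"] by blast
  ultimately show ?thesis
    unfolding N_def
    by (intro gen_field_least is_subfield_radical_closure is_subfield_gen_field) auto
qed

lemma transc_E_Z1: "transc E Z1"
  using transc_radical_closure[OF k0_X_subfield _ E_radical]
    transc_gen_field_alg_indep3(1)[OF k0 indep] by blast

lemma transc_N_Z2: "transc N Z2"
  using transc_radical_closure[OF is_subfield_gen_field _ N_radical]
    transc_gen_field_alg_indep3(2)[OF k0 indep] by blast

lemma transc_N_theta_power: "transc N (\<theta> n ^ (p ^ n))"
  using theta_power_mod_N[of 0 n] transc_add[OF subfields(2) transc_N_Z2] by auto

lemma transc_N_theta: "transc N (\<theta> n)"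
  using transc_of_power[OF subfields(2) transc_N_theta_power] .

lemma Z1_not_power_K:
  assumes "y \<in> K"
  shows "y ^ p \<noteq> Z1"
proof
  assume y: "y ^ p = Z1"
  from assms obtain n where "y \<in> gen_field N {\<theta> n}" by (auto simp: K_def T_def)
  then have "y \<in> N"
    using root_mem_of_transc[OF subfields(2) transc_N_theta] y subset_N(2) by auto
  then show False
    using transc_not_power[OF subfields(1) transc_E_Z1] y by (auto simp: N_def)
qed

section \<open>Modularity of K over M, and minimality of M\<close>

lemma modular_M_K: "modular p M K"
  unfolding modular_def
proof (intro conjI allI M_subset_K)
  fix n
  let ?P = "ppow_set p n K" and ?C = "M \<inter> ppow_set p n K"
  have P: "is_subfield ?P" by (rule is_subfield_ppow_set[OF is_subfield_K])
  have C: "is_subfield ?C"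
    using is_subfield_Inter[of "{M, ?P}"] P subfields(3) by auto
  \<comment> \<open>The reverse direction is the accessible one: its coefficients come from
    \<open>?P\<close>, whose finite subsets are spanned by powers of one element. Symmetry is
    applied at the end.\<close>
  have "lin_disjoint ?C M ?P"
  proof (rule lin_disjoint_if_common_basis[OF subfields(3)])
    fix S assume S: "finite S" "S \<subseteq> ?P"
    then have "\<forall>s. \<exists>r y. s \<in> S \<longrightarrow> y \<in> T r \<and> s = y ^ (p ^ n)"
      by (fastforce simp: ppow_set_def K_def)
    then obtain r where r: "\<And>s. s \<in> S \<Longrightarrow> \<exists>y\<in>T (r s). s = y ^ (p ^ n)" by metis
    \<comment> \<open>All preimages then lie in \<open>T R\<close>, and the summand n keeps
      \<open>R - n\<close> from being truncated.\<close>
    define R where "R = n + (\<Sum>s\<in>S. r s)"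
    define t where "t = \<theta> R ^ (p ^ n)"
    have "r s \<le> R" if "s \<in> S" for s
      using member_le_sum[of s S r] that S by (auto simp: R_def)
    then have S': "\<exists>y\<in>T R. s = y ^ (p ^ n)" if "s \<in> S" for s
      using r[OF that] T_mono[of "r s" R] that by blast
    \<comment> \<open>The basis will have p^(R-n) members: this power of t generates M over
      N.\<close>
    have td: "t ^ (p ^ (R - n)) = \<theta> R ^ (p ^ R)"
      by (simp add: t_def R_def flip: power_mult power_add)
    have transc_t: "transc N t"
      by (rule transc_of_power[OF subfields(2), of _ "R - n"])
        (simp only: td transc_N_theta_power)
    have M_eq: "gen_field N {t ^ (p ^ (R - n))} = M"
      unfolding td by (rule gen_field_theta_power)
    have tC: "t ^ (p ^ (R - n)) \<in> ?C"
    proof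
      show "t ^ (p ^ (R - n)) \<in> M"
        unfolding M_eq[symmetric] using gen_field_superset(2)[of "{t ^ (p ^ (R - n))}"] by simp
      have "\<theta> R \<in> K" using subset_T(2) by (auto simp: K_def)
      then have "t \<in> ?P" by (auto simp: t_def ppow_set_def)
      then show "t ^ (p ^ (R - n)) \<in> ?P"
        by (rule is_subring_power[OF is_subring_if_is_subfield[OF P]])
    qed
    \<comment> \<open>The p^n-th powers of N lie in both M and \<open>?P\<close>. Those of
      \<open>T R\<close> then lie in C[t], which is a field because a power of t is in C.\<close>
    have "N \<subseteq> {y. y ^ (p ^ n) \<in> ?C}"
      using subset_M(1) M_subset_K is_subring_power[OF is_subring_if_is_subfield[OF subfields(3)]]
      by (auto simp: ppow_set_def)
    then have "T R \<subseteq> {y. y ^ (p ^ n) \<in> adjoin ?C t}"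
      unfolding T_def using adjoin_superset[OF is_subring_if_is_subfield[OF C], of t]
      by (intro gen_field_least is_subfield_frob_vimage is_subfield_adjoin[OF C tC])
        (auto simp: t_def)
    then have "s \<in> adjoin ?C t" if "s \<in> S" for s
      using S'[OF that] by blast
    then have sp: "\<forall>s\<in>S. \<exists>f. (\<forall>j<p ^ (R - n). f j \<in> ?C) \<and> s = (\<Sum>j<p ^ (R - n). f j * t ^ j)"
      using adjoin_eq_span[OF C tC p_pos(1)] by blast
    have "\<forall>c. (\<forall>j<p ^ (R - n). c j \<in> M) \<and> (\<Sum>j<p ^ (R - n). c j * t ^ j) = 0
        \<longrightarrow> (\<forall>j<p ^ (R - n). c j = 0)"
      using transc_lin_indep_powers[OF subfields(2) transc_t p_pos(1)[of "R - n"]]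
      unfolding M_eq by blast
    with sp show "\<exists>t d. (\<forall>c. (\<forall>j<d. c j \<in> M) \<and> (\<Sum>j<d. c j * t j) = 0 \<longrightarrow> (\<forall>j<d. c j = 0)) \<and>
        (\<forall>s\<in>S. \<exists>f. (\<forall>j<(d::nat). f j \<in> ?C) \<and> s = (\<Sum>j<d. f j * t j))"
      by (intro exI[of _ "\<lambda>j. t ^ j"] exI[of _ "p ^ (R - n)"] conjI)
  qed simp
  then show "lin_disjoint ?C ?P M"
    by (intro lin_disjoint_sym[OF C P]) auto
qed

lemma proot_mem_of_modular:
  assumes m: "is_subfield m" "k0 \<union> {X, Z1, Z2} \<subseteq> m" "m \<subseteq> K" and mod: "modular p m K"
  shows "\<xi> n \<in> m"
proof (induction n rule: less_induct)
  case (less n)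
  note mr = is_subring_if_is_subfield[OF m(1)]
  show ?case
  proof (cases n)
    case 0
    then show ?thesis using m(2) by (simp add: proot_0)
  next
    case (Suc s)
    \<comment> \<open>The p^i-th power takes the root of index 2i+1 in the recursion to the one of
      index i+1.\<close>
    have step: "\<theta> (Suc i) ^ (p ^ Suc i) = \<theta> i ^ (p ^ i) + Z1 ^ (p ^ i) * \<xi> (Suc i)" for i
      using theta_Suc_power_power[of i i] proot_add_power[of i "Suc i" X]
      by (simp only: power_mult_distrib add_Suc_right mult_2 add.commute)
    \<comment> \<open>Unrolled, this is Z2 plus the sum of
      \<open>Z1 ^ (p ^ j) * \<xi> (Suc j)\<close> over j < i, so only roots of index at most s < n
      occur.\<close>
    have \<mu>: "\<theta> i ^ (p ^ i) \<in> m" if "i \<le> s" for i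
      using that
    proof (induction i)
      case (Suc i)
      then have xi: "\<xi> (Suc i) \<in> m" using less.IH[of "Suc i"] \<open>n = Suc s\<close> by simp
      then show ?case
        unfolding step using Suc m(2)
        by (intro is_subfieldD(3)[OF m(1) _ is_subfieldD(4)[OF m(1) is_subring_power[OF mr] xi]])
          simp_all
    qed (use m(2) in simp)
    let ?P = "ppow_set p n K" and ?b = "\<xi> n" and ?c = "\<theta> n ^ (p ^ n)"
    have P: "is_subfield ?P" by (rule is_subfield_ppow_set[OF is_subfield_K])
    have C: "is_subfield (m \<inter> ?P)"
      using is_subfield_Inter[of "{m, ?P}"] P m(1) by auto
    have Z: "Z1 ^ (p ^ s) \<in> m" using m(2) by (intro is_subring_power[OF mr]) auto
    show ?thesis
    proof (rule ccontr)
      assume b: "?b \<notin> m"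
      \<comment> \<open>The doubled index is needed because \<open>\<xi> n\<close> is the p^n-th
        power of this root.\<close>
      have "\<xi> (n + n) \<in> K" using subset_N(3) subset_M(1) M_subset_K by blast
      then have bP: "?b \<in> ?P"
        using proot_add_power[of n n X] unfolding ppow_set_def by (metis imageI)
      have "\<theta> n \<in> K" using subset_T(2) by (auto simp: K_def)
      then have cP: "?c \<in> ?P" by (auto simp: ppow_set_def)
      have dep: "?c = \<theta> s ^ (p ^ s) + Z1 ^ (p ^ s) * ?b" unfolding Suc by (rule step)
      obtain \<alpha> \<beta> where ab: "\<alpha> \<in> m \<inter> ?P" "\<beta> \<in> m \<inter> ?P" "?c = \<alpha> + \<beta> * ?b"
        using lin_disjoint_one_dependent[OF C m(1) _ is_subfieldD(2)[OF P] bP cP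
            \<mu>[OF order_refl] Z dep] mod b unfolding modular_def by auto
      \<comment> \<open>The two affine expressions of \<open>?c\<close> are compared: unequal
        coefficients would allow solving for \<open>?b\<close> inside m.\<close>
      have "(\<beta> - Z1 ^ (p ^ s)) * ?b = \<theta> s ^ (p ^ s) - \<alpha>"
        using dep ab(3) by (simp add: algebra_simps)
      moreover have "?b = ((\<beta> - Z1 ^ (p ^ s)) * ?b) / (\<beta> - Z1 ^ (p ^ s))"
        if "\<beta> \<noteq> Z1 ^ (p ^ s)" using that by simp
      ultimately have "?b \<in> m" if "\<beta> \<noteq> Z1 ^ (p ^ s)"
        using that is_subfieldD(7,8)[OF m(1)] ab(1,2) \<mu>[OF order_refl] Z by (metis IntD1)
      then have "\<beta> = Z1 ^ (p ^ s)" using b by blast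
      with ab(2) obtain y where y: "y \<in> K" "y ^ (p ^ n) = Z1 ^ (p ^ s)"
        by (auto simp: ppow_set_def)
      \<comment> \<open>As n = s + 1, cancelling p^s-th powers leaves a p-th root of Z1 in
        K.\<close>
      have "(y ^ p) ^ (p ^ s) = Z1 ^ (p ^ s)" using y(2) by (simp add: Suc power_mult)
      then show False using Z1_not_power_K[OF y(1)] by (simp add: frob_inj)
    qed
  qed
qed

text \<open>The root descends past Z2 and then Z1 into k0(X), where a degree comparison excludes
  it.\<close>

lemma X_root_not_mem: "\<xi> 1 \<notin> gen_field (gen_field (gen_field k0 {X}) {Z1}) {Z2}"
proof
  assume *: "\<xi> 1 \<in> gen_field (gen_field (gen_field k0 {X}) {Z1}) {Z2}"
  have xp: "\<xi> 1 ^ p = X" using proot_power[of 1 X] by simp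
  have X1: "X \<in> gen_field k0 {X}" using gen_field_superset(2)[of "{X}"] by simp
  then have X2: "X \<in> gen_field (gen_field k0 {X}) {Z1}" using gen_field_superset(1) by blast
  note t = transc_gen_field_alg_indep3[OF k0 indep]
  have "\<xi> 1 \<in> gen_field (gen_field k0 {X}) {Z1}"
    using root_mem_of_transc[OF is_subfield_gen_field t(2) *] X2 xp by simp
  then have "\<xi> 1 \<in> gen_field k0 {X}"
    using root_mem_of_transc[OF is_subfield_gen_field t(1)] X1 xp by simp
  then show False
    using transc_not_power[OF k0 transc_alg_indep3_X[OF k0 indep]] xp by blast
qed

end

section \<open>The field lm(K/k) and the failure of lq-modularity\<close>

theorem mainTheorem4:
  fixes p :: nat and k0 :: "'a::field set" and X Z1 Z2 :: 'a
  assumes "prime p"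
    and "of_nat p = (0::'a)"
    and "\<forall>x::'a. \<exists>y. y ^ p = x"
    and "is_subfield k0"
    and "\<forall>x\<in>k0. \<exists>y\<in>k0. y ^ p = x"
    and "alg_indep3 k0 X Z1 Z2"
    and "k = gen_field k0 {X, Z1, Z2}"
    and "\<forall>n. Kn n = gen_field k {proot p (2 * n) X, theta p X Z1 Z2 n}"
    and "K = (\<Union>n\<in>{1..}. Kn n)"
  shows "is_lm p k K (gen_field k (range (\<lambda>n. proot p n X))) \<and> \<not> lq_modular p k K"
proof -
  interpret theta_tower p "TYPE('a)" k0 X Z1 Z2
    using assms(1-4,6) by unfold_locales auto
  note k_def = assms(7) and Kn_def = assms(8) and K_eq_UN = assms(9)
  have kf: "is_subfield k" unfolding k_def by (rule is_subfield_gen_field)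
  have k_gens: "k0 \<union> {X, Z1, Z2} \<subseteq> k"
    unfolding k_def
    using gen_field_superset(1)[of k0 "{X, Z1, Z2}"] gen_field_superset(2)[of "{X, Z1, Z2}" k0]
    by simp
  have k_least: "k \<subseteq> S" if "is_subfield S" "k0 \<union> {X, Z1, Z2} \<subseteq> S" for S
    unfolding k_def using that by (intro gen_field_least) auto
  have X_M: "X \<in> M" using subset_N(3)[of 0] subset_M(1) by (auto simp: proot_0)
  have k_M: "k \<subseteq> M"
    using subset_E(1) subset_N subset_M X_M by (intro k_least subfields) auto
  \<comment> \<open>The same generators over k0, adjoined in another order.\<close>
  have M_eq: "gen_field k (range \<xi>) = M"
  proof
    show "gen_field k (range \<xi>) \<subseteq> M"
      using k_M subset_N(3) subset_M(1) by (intro gen_field_least subfields) auto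
    note sup = gen_field_superset(1)[of k "range \<xi>"] gen_field_superset(2)[of "range \<xi>" k]
    have "E \<subseteq> gen_field k (range \<xi>)"
      unfolding E_def using k_gens sup by (intro gen_field_least is_subfield_gen_field) auto
    then have "N \<subseteq> gen_field k (range \<xi>)"
      unfolding N_def using k_gens sup(1) by (intro gen_field_least is_subfield_gen_field) auto
    then show "M \<subseteq> gen_field k (range \<xi>)"
      unfolding M_def using k_gens sup(1) by (intro gen_field_least is_subfield_gen_field) auto
  qed
  have Kn_T: "Kn n \<subseteq> T n" for n
    using k_M T_0 T_mono[of 0 n] subset_N(3)[of "2 * n"] subset_T[of n] unfolding Kn_def[rule_format]
    by (intro gen_field_least subfields) auto
  have Kn_gens: "k \<subseteq> Kn n" "\<xi> (2 * n) \<in> Kn n" "\<theta> n \<in> Kn n" for n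
    using gen_field_superset(1)[of k "{\<xi> (2 * n), \<theta> n}"]
      gen_field_superset(2)[of "{\<xi> (2 * n), \<theta> n}" k] unfolding Kn_def[rule_format] by auto
  have Kn_field: "is_subfield (Kn n)" for n
    unfolding Kn_def[rule_format] by (rule is_subfield_gen_field)
  note Kn_ring = is_subring_if_is_subfield[OF Kn_field]
  have \<xi>_Kn: "\<xi> m \<in> Kn n" if "m \<le> 2 * n" for m n
  proof -
    have "\<xi> m = \<xi> (2 * n) ^ (p ^ (2 * n - m))"
      using proot_add_power[of "2 * n - m" m X] that by simp
    then show ?thesis using is_subring_power[OF Kn_ring Kn_gens(2)] by metis
  qed
  have Kn_Suc: "Kn n \<subseteq> Kn (Suc n)" for n
  proof -
    have "\<theta> n = \<theta> (Suc n) ^ p - Z1 * \<xi> (Suc (2 * n))"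
      using theta_Suc_power[of n] by simp
    moreover have "\<theta> (Suc n) ^ p \<in> Kn (Suc n)"
      by (rule is_subring_power[OF Kn_ring Kn_gens(3)])
    moreover have "Z1 * \<xi> (Suc (2 * n)) \<in> Kn (Suc n)"
      using k_gens Kn_gens(1) by (intro is_subfieldD(4)[OF Kn_field] \<xi>_Kn) auto
    ultimately have "\<theta> n \<in> Kn (Suc n)"
      using is_subfieldD(7)[OF Kn_field] by metis
    then show ?thesis
      unfolding Kn_def[rule_format, of n] using Kn_gens(1) \<xi>_Kn[of "2 * n" "Suc n"]
      by (intro gen_field_least Kn_field) auto
  qed
  \<comment> \<open>The given union starts at 1; since \<open>Kn 0 \<subseteq> Kn 1\<close>, index 0
    may be included and the result on increasing unions applies.\<close>
  have UN_Kn: "(\<Union>n. Kn n) = K"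
  proof -
    have "Kn 0 \<subseteq> Kn 1" using Kn_Suc[of 0] by simp
    then have "Kn n \<subseteq> K" for n
      unfolding K_eq_UN by (cases n) auto
    then show ?thesis unfolding K_eq_UN by auto
  qed
  have K_field: "is_subfield K"
    unfolding UN_Kn[symmetric] by (intro is_subfield_UN_mono Kn_field Kn_Suc)
  have k_K: "k \<subseteq> K" and \<xi>_K: "\<xi> n \<in> K" and \<theta>_K: "\<theta> n \<in> K" for n
    unfolding UN_Kn[symmetric] using Kn_gens[of n] \<xi>_Kn[of n n] by auto
  \<comment> \<open>The towers are compared in the union: \<open>T n\<close> contains all roots of
    X, while \<open>Kn n\<close> is generated with those up to index 2n.\<close>
  have K: "K = theta_tower.K p k0 X Z1 Z2"
  proof
    show "K \<subseteq> theta_tower.K p k0 X Z1 Z2"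
      unfolding UN_Kn[symmetric] K_def using Kn_T by blast
    have "E \<subseteq> K"
      unfolding E_def using k_gens k_K \<xi>_K by (intro gen_field_least K_field) auto
    then have "N \<subseteq> K"
      unfolding N_def using k_gens k_K by (intro gen_field_least K_field) auto
    then have "T n \<subseteq> K" for n
      unfolding T_def using \<theta>_K by (intro gen_field_least K_field) auto
    then show "theta_tower.K p k0 X Z1 Z2 \<subseteq> K" unfolding K_def by blast
  qed
  have \<xi>_mem: "\<xi> n \<in> m" if "is_subfield m" "k \<subseteq> m" "m \<subseteq> K" "modular p m K" for m n
    using proot_mem_of_modular[of m n] that k_gens unfolding K by blast
  have "is_lm p k K M"
    unfolding is_lm_def
  proof (intro conjI allI impI)
    show "is_subfield M" "k \<subseteq> M" by (fact subfields(3) k_M)+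
    show "M \<subseteq> K" "modular p M K" unfolding K by (fact M_subset_K modular_M_K)+
    fix m assume "is_subfield m \<and> k \<subseteq> m \<and> m \<subseteq> K \<and> modular p m K"
    then show "M \<subseteq> m"
      unfolding M_eq[symmetric] using \<xi>_mem by (intro gen_field_least) auto
  qed
  moreover have "\<not> lq_modular p k K"
  proof
    assume "lq_modular p k K"
    then obtain L where L: "is_subfield L" "k \<subseteq> L" "L \<subseteq> K" "fin_dim k L" "modular p L K"
      and pi: "purely_insep p k K"
      unfolding lq_modular_def by blast
    obtain e where e: "\<And>y. y \<in> L \<Longrightarrow> y ^ (p ^ e) \<in> k"
      using fin_dim_bounded_exponent[OF kf L(4,3) pi] by blast
    \<comment> \<open>The index e + 1 makes the p^e-th power equal to
      \<open>\<xi> 1\<close>.\<close>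
    have "\<xi> (e + 1) ^ (p ^ e) \<in> k" using e \<xi>_mem[OF L(1,2,3,5)] by blast
    then have "\<xi> 1 \<in> k" by (simp only: proot_add_power)
    \<comment> \<open>The generators are adjoined one by one, as the descent in
      \<open>X_root_not_mem\<close> requires.\<close>
    moreover have "k \<subseteq> gen_field (gen_field (gen_field k0 {X}) {Z1}) {Z2}"
    proof (intro k_least is_subfield_gen_field)
      show "k0 \<union> {X, Z1, Z2} \<subseteq> gen_field (gen_field (gen_field k0 {X}) {Z1}) {Z2}"
        using gen_field_superset(1)[of k0 "{X}"] gen_field_superset(2)[of "{X}" k0]
          gen_field_superset(1)[of "gen_field k0 {X}" "{Z1}"]
          gen_field_superset(2)[of "{Z1}" "gen_field k0 {X}"]
          gen_field_superset(1)[of "gen_field (gen_field k0 {X}) {Z1}" "{Z2}"]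
          gen_field_superset(2)[of "{Z2}" "gen_field (gen_field k0 {X}) {Z1}"]
        by auto
    qed
    ultimately show False using X_root_not_mem by blast
  qed
  ultimately show ?thesis unfolding M_eq by blast
qed

end
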